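(* Let $\Delta$ and $I$ be (possibly infinite) sets with $|\Delta|\geqslant 2$, let $M$ be a transitive subgroup of $\mathrm{Sym}(\Delta)$, let $T$ be a non-trivial subgroup of $\mathrm{Sym}(I)$, and fix $\delta\in\Delta$. The product action of the restricted wreath product $G=M\,\mathrm{wr}\,T$ on $\mathrm{res}_\delta(\Delta^I)$ is semiprimitive if and only if either - $M$ is semiprimitive and non-regular, and $T$ is transitive on $I$; or - $M$ is regular and perfect, and $T$ acts faithfully on each $T$-orbit on $I$.
   Context: A permutation group is semiregular if all its point-stabilisers are trivial, and regular if it is semiregular and transitive. A transitive permutation group is semiprimitive if every normal subgroup is transitive or semiregular. $\Delta^I$ is the set of functions $f:I\to\Delta$, and $\mathrm{res}_\delta(\Delta^I)$ is the set of those $f$ with $f(i)=\delta$ for all but finitely many $i\in I$. $M^I$ is the group of functions $I\to M$ under pointwise multiplication, and $\mathrm{res}(M^I)$ is its normal subgroup of functions $h$ with $h(i)=1$ for all but finitely many $i$. $M^I$ acts on $\Delta^I$ by $f^h(i)=f(i)^{h(i)}$, and $T$ acts on $\Delta^I$ by $f^t(i)=f(it^{-1})$. The set $\mathrm{res}_\delta(\Delta^I)$ is preserved by $\mathrm{res}(M^I)$ and by $T$, and the restricted wreath product is $M\,\mathrm{wr}\,T=\langle\mathrm{res}(M^I),T\rangle=\mathrm{res}(M^I)\rtimes T\leqslant\mathrm{Sym}(\mathrm{res}_\delta(\Delta^I))$. *)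

theory Defs
  imports "HOL-Algebra.Algebra"
begin

text \<open>
  A permutation group on \<open>\<Omega>\<close> is a subgroup \<open>H\<close> of \<^term>\<open>BijGroup \<Omega>\<close>. Permutations act on the left
  here, as composition in \<^const>\<open>BijGroup\<close> demands. Replacing a right action by this left action
  turns the group into its opposite, with the same underlying set of permutations.
\<close>

definition perm_grp :: "'a set \<Rightarrow> ('a \<Rightarrow> 'a) set \<Rightarrow> ('a \<Rightarrow> 'a) monoid"
  where "perm_grp \<Omega> H = (BijGroup \<Omega>)\<lparr>carrier := H\<rparr>"

definition transitive_perm :: "'a set \<Rightarrow> ('a \<Rightarrow> 'a) set \<Rightarrow> bool"
  where "transitive_perm \<Omega> H \<longleftrightarrow> transitive_action (perm_grp \<Omega> H) \<Omega> (\<lambda>h. h)"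

definition semiregular_perm :: "'a set \<Rightarrow> ('a \<Rightarrow> 'a) set \<Rightarrow> bool"
  where "semiregular_perm \<Omega> H \<longleftrightarrow>
    subgroup H (BijGroup \<Omega>) \<and>
    (\<forall>x\<in>\<Omega>. stabilizer (perm_grp \<Omega> H) (\<lambda>h. h) x = {\<one>\<^bsub>BijGroup \<Omega>\<^esub>})"

definition regular_perm :: "'a set \<Rightarrow> ('a \<Rightarrow> 'a) set \<Rightarrow> bool"
  where "regular_perm \<Omega> H \<longleftrightarrow> semiregular_perm \<Omega> H \<and> transitive_perm \<Omega> H"

definition semiprimitive_perm :: "'a set \<Rightarrow> ('a \<Rightarrow> 'a) set \<Rightarrow> bool"
  where "semiprimitive_perm \<Omega> H \<longleftrightarrow>
    transitive_perm \<Omega> H \<and>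
    (\<forall>N. N \<lhd> perm_grp \<Omega> H \<longrightarrow> transitive_perm \<Omega> N \<or> semiregular_perm \<Omega> N)"

definition perfect_perm :: "'a set \<Rightarrow> ('a \<Rightarrow> 'a) set \<Rightarrow> bool"
  where "perfect_perm \<Omega> H \<longleftrightarrow> derived (perm_grp \<Omega> H) H = H"

definition faithful_on_orbits :: "'a set \<Rightarrow> ('a \<Rightarrow> 'a) set \<Rightarrow> bool"
  where "faithful_on_orbits \<Omega> H \<longleftrightarrow>
    (\<forall>U \<in> orbits (perm_grp \<Omega> H) \<Omega> (\<lambda>h. h).
       faithful_action (perm_grp \<Omega> H) U (\<lambda>h. restrict h U))"

text \<open>The set \<open>res\<^sub>\<delta>(\<Delta>\<^sup>I)\<close>.\<close>

definition res_pow :: "'i set \<Rightarrow> 'd set \<Rightarrow> 'd \<Rightarrow> ('i \<Rightarrow> 'd) set"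
  where "res_pow I \<Delta> \<delta> = {f \<in> I \<rightarrow>\<^sub>E \<Delta>. finite {i \<in> I. f i \<noteq> \<delta>}}"

definition base_perm :: "'i set \<Rightarrow> 'd set \<Rightarrow> 'd \<Rightarrow> ('i \<Rightarrow> 'd \<Rightarrow> 'd) \<Rightarrow> ('i \<Rightarrow> 'd) \<Rightarrow> ('i \<Rightarrow> 'd)"
  where "base_perm I \<Delta> \<delta> h = (\<lambda>f \<in> res_pow I \<Delta> \<delta>. \<lambda>i\<in>I. h i (f i))"

definition top_perm :: "'i set \<Rightarrow> 'd set \<Rightarrow> 'd \<Rightarrow> ('i \<Rightarrow> 'i) \<Rightarrow> ('i \<Rightarrow> 'd) \<Rightarrow> ('i \<Rightarrow> 'd)"
  where "top_perm I \<Delta> \<delta> t = (\<lambda>f \<in> res_pow I \<Delta> \<delta>. \<lambda>i\<in>I. f ((inv\<^bsub>BijGroup I\<^esub> t) i))"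

text \<open>
  The restricted wreath product in product action, as a set of permutations of
  \<^term>\<open>res_pow I \<Delta> \<delta>\<close>. The group \<open>res(M\<^sup>I)\<close> is the restricted direct power \<^const>\<open>sum_group\<close>, which
  does not require the factors to be abelian.
\<close>

definition res_wreath ::
    "'i set \<Rightarrow> 'd set \<Rightarrow> 'd \<Rightarrow> ('d \<Rightarrow> 'd) set \<Rightarrow> ('i \<Rightarrow> 'i) set \<Rightarrow> (('i \<Rightarrow> 'd) \<Rightarrow> ('i \<Rightarrow> 'd)) set"
  where "res_wreath I \<Delta> \<delta> M T =
    generate (BijGroup (res_pow I \<Delta> \<delta>))
      (base_perm I \<Delta> \<delta> ` carrier (sum_group I (\<lambda>_. perm_grp \<Delta> M)) \<union> top_perm I \<Delta> \<delta> ` T)"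

lemma group_perm_grp: "subgroup H (BijGroup \<Omega>) \<Longrightarrow> group (perm_grp \<Omega> H)"
  unfolding perm_grp_def by (rule subgroup.subgroup_is_group[OF _ group_BijGroup])

lemma perm_grp_simps [simp]:
  "carrier (perm_grp \<Omega> H) = H"
  "monoid.mult (perm_grp \<Omega> H) = monoid.mult (BijGroup \<Omega>)"
  "one (perm_grp \<Omega> H) = one (BijGroup \<Omega>)"
  by (simp_all add: perm_grp_def)

lemma one_BijGroup [simp]: "\<one>\<^bsub>BijGroup \<Omega>\<^esub> = (\<lambda>x\<in>\<Omega>. x)"
  by (simp add: BijGroup_def)

lemma carrier_BijGroup: "carrier (BijGroup \<Omega>) = Bij \<Omega>"
  by (simp add: BijGroup_def)

lemma mult_BijGroup: "g \<in> Bij \<Omega> \<Longrightarrow> f \<in> Bij \<Omega> \<Longrightarrow> g \<otimes>\<^bsub>BijGroup \<Omega>\<^esub> f = compose \<Omega> g f"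
  by (simp add: BijGroup_def)

lemma subgroup_Bij: "subgroup H (BijGroup \<Omega>) \<Longrightarrow> h \<in> H \<Longrightarrow> h \<in> Bij \<Omega>"
  using subgroup.subset carrier_BijGroup by blast

lemma group_action_perm_iff:
  "group_action (perm_grp \<Omega> H) \<Omega> (\<lambda>h. h) \<longleftrightarrow> subgroup H (BijGroup \<Omega>)"
proof
  assume "group_action (perm_grp \<Omega> H) \<Omega> (\<lambda>h. h)"
  then interpret group_hom "perm_grp \<Omega> H" "BijGroup \<Omega>" "\<lambda>h. h"
    by (rule group_action.group_hom)
  show "subgroup H (BijGroup \<Omega>)"
    using img_is_subgroup by simp
next
  assume H: "subgroup H (BijGroup \<Omega>)"
  show "group_action (perm_grp \<Omega> H) \<Omega> (\<lambda>h. h)"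
    by (auto simp: group_action_def group_hom_def group_hom_axioms_def hom_def
        group_perm_grp[OF H] group_BijGroup carrier_BijGroup subgroup_Bij[OF H])
qed

lemma transitive_perm_iff:
  "transitive_perm \<Omega> H \<longleftrightarrow>
     subgroup H (BijGroup \<Omega>) \<and> (\<forall>x\<in>\<Omega>. \<forall>y\<in>\<Omega>. \<exists>h\<in>H. h x = y)"
  unfolding transitive_perm_def transitive_action_def transitive_action_axioms_def
    group_action_perm_iff by auto

lemma restrict_orbit_action:
  assumes H: "subgroup H (BijGroup \<Omega>)" and U: "U \<in> orbits (perm_grp \<Omega> H) \<Omega> (\<lambda>h. h)"
  shows "group_action (perm_grp \<Omega> H) U (\<lambda>h. restrict h U)"
proof -
  interpret A: group_action "perm_grp \<Omega> H" \<Omega> "\<lambda>h. h"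
    using H by (simp add: group_action_perm_iff)
  obtain x where x: "x \<in> \<Omega>" and Ux: "U = {g x | g. g \<in> H}"
    using U by (auto simp: orbits_def orbit_def)
  have sub: "U \<subseteq> \<Omega>"
    using x Ux A.element_image[of _ x] by auto
  have comp: "(g \<otimes>\<^bsub>BijGroup \<Omega>\<^esub> h) y = g (h y)" if "g \<in> H" "h \<in> H" "y \<in> \<Omega>" for g h y
    using A.composition_rule[of y g h] that by simp
  have cl: "g y \<in> U" if g: "g \<in> H" and y: "y \<in> U" for g y
  proof -
    obtain k where k: "k \<in> H" "y = k x" using y Ux by auto
    have "g y = (g \<otimes>\<^bsub>BijGroup \<Omega>\<^esub> k) x" using comp[OF g k(1) x] k by simp
    then show ?thesis using Ux subgroup.m_closed[OF H g k(1)] by auto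
  qed
  have bij: "restrict g U \<in> Bij U" if g: "g \<in> H" for g
  proof -
    have gi: "inv\<^bsub>BijGroup \<Omega>\<^esub> g \<in> H" using subgroup.m_inv_closed[OF H g] .
    interpret B: group "BijGroup \<Omega>" by (rule group_BijGroup)
    have gB: "g \<in> carrier (BijGroup \<Omega>)" using subgroup.subset[OF H] g by auto
    have "bij_betw g U U"
    proof (rule bij_betw_byWitness[where f' = "inv\<^bsub>BijGroup \<Omega>\<^esub> g"])
      show "\<forall>a\<in>U. (inv\<^bsub>BijGroup \<Omega>\<^esub> g) (g a) = a"
        using comp[OF gi g] B.l_inv[OF gB] sub by fastforce
      show "\<forall>a\<in>U. g ((inv\<^bsub>BijGroup \<Omega>\<^esub> g) a) = a"
        using comp[OF g gi] B.r_inv[OF gB] sub by fastforce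
    qed (use cl g gi in auto)
    then show ?thesis by (auto simp: Bij_def)
  qed
  have hom: "restrict (g \<otimes>\<^bsub>BijGroup \<Omega>\<^esub> h) U = restrict g U \<otimes>\<^bsub>BijGroup U\<^esub> restrict h U"
    if "g \<in> H" "h \<in> H" for g h
  proof (rule ext)
    show "restrict (g \<otimes>\<^bsub>BijGroup \<Omega>\<^esub> h) U y = (restrict g U \<otimes>\<^bsub>BijGroup U\<^esub> restrict h U) y" for y
      unfolding mult_BijGroup[OF bij[OF that(1)] bij[OF that(2)]]
      using comp[OF that, of y] cl[OF that(2), of y] sub by (auto simp: compose_def)
  qed
  with bij show ?thesis
    unfolding group_action_def group_hom_def group_hom_axioms_def hom_def
    using group_perm_grp[OF H] group_BijGroup by (simp add: carrier_BijGroup)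
qed

lemma base_perm_Bij:
  assumes M: "subgroup M (BijGroup \<Delta>)" and h: "h \<in> carrier (sum_group I (\<lambda>_. perm_grp \<Delta> M))"
    and \<delta>: "\<delta> \<in> \<Delta>"
  shows "base_perm I \<Delta> \<delta> h \<in> Bij (res_pow I \<Delta> \<delta>)"
proof -
  let ?R = "res_pow I \<Delta> \<delta>"
  have hM: "\<And>i. i \<in> I \<Longrightarrow> h i \<in> Bij \<Delta>" and fin: "finite {i \<in> I. h i \<noteq> (\<lambda>x\<in>\<Delta>. x)}"
    using h subgroup_Bij[OF M] by (auto simp: carrier_sum_group group_perm_grp[OF M] PiE_iff)
  define k where "k = (\<lambda>i. inv_into \<Delta> (h i))"
  have bh: "bij_betw (h i) \<Delta> \<Delta>" if "i \<in> I" for i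
    using hM[OF that] by (simp add: Bij_def)
  have kh: "k i (h i x) = x" "h i (k i x) = x" "h i x \<in> \<Delta>" "k i x \<in> \<Delta>"
    if "i \<in> I" "x \<in> \<Delta>" for i x
    using bh[OF that(1)] that(2)
    by (auto simp: k_def bij_betw_inv_into_left bij_betw_inv_into_right bij_betw_apply
        bij_betw_apply[OF bij_betw_inv_into])
  have inR: "(\<lambda>i\<in>I. p i (f i)) \<in> ?R"
    if p: "\<And>i x. i \<in> I \<Longrightarrow> x \<in> \<Delta> \<Longrightarrow> p i x \<in> \<Delta>"
      and pd: "\<And>i. i \<in> I \<Longrightarrow> h i = (\<lambda>x\<in>\<Delta>. x) \<Longrightarrow> p i \<delta> = \<delta>" and f: "f \<in> ?R" for p f
  proof -
    have "{i \<in> I. (\<lambda>i\<in>I. p i (f i)) i \<noteq> \<delta>} \<subseteq> {i \<in> I. h i \<noteq> (\<lambda>x\<in>\<Delta>. x)} \<union> {i \<in> I. f i \<noteq> \<delta>}"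
      using pd by auto
    then have "finite {i \<in> I. (\<lambda>i\<in>I. p i (f i)) i \<noteq> \<delta>}"
      using fin f by (simp add: res_pow_def finite_subset)
    then show ?thesis using p f by (auto simp: res_pow_def)
  qed
  have kd: "k i \<delta> = \<delta>" if "i \<in> I" "h i = (\<lambda>x\<in>\<Delta>. x)" for i
    using kh(1)[OF that(1) \<delta>] that(2) \<delta> by simp
  have "bij_betw (\<lambda>f. \<lambda>i\<in>I. h i (f i)) ?R ?R"
  proof (rule bij_betw_byWitness[where f' = "\<lambda>f. \<lambda>i\<in>I. k i (f i)"])
    show "(\<lambda>f. \<lambda>i\<in>I. h i (f i)) ` ?R \<subseteq> ?R" using inR[of h] kh(3) \<delta> by auto
    show "(\<lambda>f. \<lambda>i\<in>I. k i (f i)) ` ?R \<subseteq> ?R" using inR[of k] kh(4) kd by auto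
  qed (use kh(1,2) in \<open>auto simp: res_pow_def PiE_iff extensional_def fun_eq_iff\<close>)
  then show ?thesis by (simp add: base_perm_def Bij_def)
qed

lemma top_perm_Bij:
  assumes t: "t \<in> Bij I"
  shows "top_perm I \<Delta> \<delta> t \<in> Bij (res_pow I \<Delta> \<delta>)"
proof -
  let ?R = "res_pow I \<Delta> \<delta>"
  define s where "s = inv\<^bsub>BijGroup I\<^esub> t"
  interpret B: group "BijGroup I" by (rule group_BijGroup)
  have s: "s \<in> Bij I"
    using B.inv_closed[of t] t by (simp add: s_def carrier_BijGroup)
  have ts: "t (s i) = i" "s (t i) = i" "t i \<in> I" "s i \<in> I" if "i \<in> I" for i
  proof -
    have "compose I t s = (\<lambda>x\<in>I. x)" "compose I s t = (\<lambda>x\<in>I. x)"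
      using B.r_inv[of t, folded s_def] B.l_inv[of t, folded s_def] t
      unfolding carrier_BijGroup mult_BijGroup[OF t s] mult_BijGroup[OF s t] by simp_all
    then show "t (s i) = i" "s (t i) = i"
      using that by (metis compose_eq restrict_apply')+
    show "t i \<in> I" "s i \<in> I" using that Bij_imp_funcset[OF t] Bij_imp_funcset[OF s] by auto
  qed
  have inR: "(\<lambda>i\<in>I. f (p i)) \<in> ?R"
    if p: "\<And>i. i \<in> I \<Longrightarrow> p i \<in> I" and qp: "\<And>i. i \<in> I \<Longrightarrow> q (p i) = i" and f: "f \<in> ?R" for p q f
  proof -
    have "{i \<in> I. (\<lambda>i\<in>I. f (p i)) i \<noteq> \<delta>} \<subseteq> q ` {i \<in> I. f i \<noteq> \<delta>}"
      using p qp by (force simp: image_iff)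
    moreover have "finite {i \<in> I. f i \<noteq> \<delta>}"
      using f by (simp add: res_pow_def)
    ultimately have "finite {i \<in> I. (\<lambda>i\<in>I. f (p i)) i \<noteq> \<delta>}"
      by (rule finite_surj[rotated])
    then show ?thesis using p f by (auto simp: res_pow_def)
  qed
  have "bij_betw (\<lambda>f. \<lambda>i\<in>I. f (s i)) ?R ?R"
  proof (rule bij_betw_byWitness[where f' = "\<lambda>f. \<lambda>i\<in>I. f (t i)"])
    show "(\<lambda>f. \<lambda>i\<in>I. f (s i)) ` ?R \<subseteq> ?R" using inR[of s t] ts by auto
    show "(\<lambda>f. \<lambda>i\<in>I. f (t i)) ` ?R \<subseteq> ?R" using inR[of t s] ts by auto
  qed (use ts in \<open>auto simp: res_pow_def PiE_iff extensional_def fun_eq_iff\<close>)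
  then show ?thesis by (simp add: top_perm_def Bij_def s_def)
qed

lemma subgroup_res_wreath:
  assumes "subgroup M (BijGroup \<Delta>)" "subgroup T (BijGroup I)" "\<delta> \<in> \<Delta>"
  shows "subgroup (res_wreath I \<Delta> \<delta> M T) (BijGroup (res_pow I \<Delta> \<delta>))"
proof -
  interpret B: group "BijGroup (res_pow I \<Delta> \<delta>)" by (rule group_BijGroup)
  show ?thesis
    unfolding res_wreath_def
    by (intro B.generate_is_subgroup)
      (auto simp: carrier_BijGroup base_perm_Bij[OF assms(1) _ assms(3)]
        top_perm_Bij subgroup_Bij[OF assms(2)])
qed

end

theory Submission
  imports Defs
begin

text \<open>
  The elements of a semiprimitive group that fix every class of an invariant equivalence relation
  form a normal subgroup, so they act semiregularly unless there is only one class. This gives all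
  the necessary conditions: apply it to the coordinatewise orbit relation of a normal subgroup of
  \<open>M\<close> (semiprimitivity of \<open>M\<close>), to agreement on a \<open>T\<close>-invariant set of coordinates (transitivity
  of \<open>T\<close> for non-regular \<open>M\<close>, faithfulness on orbits), and, for regular \<open>M\<close>, to the product of the
  coordinates modulo the derived subgroup (perfectness of \<open>M\<close>).

  Conversely, let \<open>N\<close> be normal and let \<open>n \<in> N\<close>. Commutators with elements supported on one
  coordinate \<open>i\<close> put into \<open>N\<close> all \<open>[h, y]\<close> at \<open>i\<close>, where \<open>h\<close> is the \<open>i\<close>-th component of \<open>n\<close> if \<open>n\<close> is
  in the base group, and \<open>h \<in> M\<close> is arbitrary if \<open>n\<close> moves \<open>i\<close>. If \<open>N\<close> is not semiregular,
  these commutators force the elements of \<open>N\<close> supported on \<open>i\<close> to be transitive on \<open>\<Delta>\<close>.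
\<close>

subsection \<open>Permutation groups\<close>

lemma perm_mult_apply:
  "g \<in> Bij \<Omega> \<Longrightarrow> f \<in> Bij \<Omega> \<Longrightarrow> x \<in> \<Omega> \<Longrightarrow> (g \<otimes>\<^bsub>BijGroup \<Omega>\<^esub> f) x = g (f x)"
  by (simp add: mult_BijGroup compose_eq)

lemma Bij_apply: "g \<in> Bij \<Omega> \<Longrightarrow> x \<in> \<Omega> \<Longrightarrow> g x \<in> \<Omega>"
  using Bij_imp_funcset by blast

lemma Bij_inj: "g \<in> Bij \<Omega> \<Longrightarrow> x \<in> \<Omega> \<Longrightarrow> y \<in> \<Omega> \<Longrightarrow> g x = g y \<longleftrightarrow> x = y"
  by (auto simp: Bij_def bij_betw_def inj_on_def)

lemma perm_inv_apply:
  assumes "g \<in> Bij \<Omega>" "x \<in> \<Omega>"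
  shows "(inv\<^bsub>BijGroup \<Omega>\<^esub> g) (g x) = x" "g ((inv\<^bsub>BijGroup \<Omega>\<^esub> g) x) = x"
  using assms Bij_apply[OF assms]
  by (auto simp: inv_BijGroup Bij_def bij_betw_inv_into_left bij_betw_inv_into_right)

lemma Bij_eqI:
  "g \<in> Bij \<Omega> \<Longrightarrow> f \<in> Bij \<Omega> \<Longrightarrow> (\<And>x. x \<in> \<Omega> \<Longrightarrow> g x = f x) \<Longrightarrow> g = f"
  by (meson Bij_imp_extensional extensionalityI)

text \<open>The factors are ordered as in \<open>derived_set\<close>, so up to
  \<open>inv_perm_grp\<close> these are the generators of \<open>derived\<close>.\<close>

abbreviation commutator :: "'a set \<Rightarrow> ('a \<Rightarrow> 'a) \<Rightarrow> ('a \<Rightarrow> 'a) \<Rightarrow> ('a \<Rightarrow> 'a)"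
  where "commutator \<Omega> g h \<equiv>
    g \<otimes>\<^bsub>BijGroup \<Omega>\<^esub> h \<otimes>\<^bsub>BijGroup \<Omega>\<^esub> inv\<^bsub>BijGroup \<Omega>\<^esub> g \<otimes>\<^bsub>BijGroup \<Omega>\<^esub> inv\<^bsub>BijGroup \<Omega>\<^esub> h"

locale perm_group =
  fixes \<Omega> :: "'a set" and H :: "('a \<Rightarrow> 'a) set"
  assumes subgroup_H: "subgroup H (BijGroup \<Omega>)"
begin


lemma H_Bij: "h \<in> H \<Longrightarrow> h \<in> Bij \<Omega>"
  using subgroup_H by (rule subgroup_Bij)

lemma H_closed [simp, intro]:
  "(\<lambda>x\<in>\<Omega>. x) \<in> H"
  "g \<in> H \<Longrightarrow> h \<in> H \<Longrightarrow> g \<otimes>\<^bsub>BijGroup \<Omega>\<^esub> h \<in> H"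
  "h \<in> H \<Longrightarrow> inv\<^bsub>BijGroup \<Omega>\<^esub> h \<in> H"
  using subgroup_H subgroup.one_closed[OF subgroup_H]
  by (auto intro: subgroup.m_closed subgroup.m_inv_closed)

lemma H_apply [simp]:
  "h \<in> H \<Longrightarrow> x \<in> \<Omega> \<Longrightarrow> h x \<in> \<Omega>"
  "g \<in> H \<Longrightarrow> h \<in> H \<Longrightarrow> x \<in> \<Omega> \<Longrightarrow> (g \<otimes>\<^bsub>BijGroup \<Omega>\<^esub> h) x = g (h x)"
  "h \<in> H \<Longrightarrow> x \<in> \<Omega> \<Longrightarrow> (inv\<^bsub>BijGroup \<Omega>\<^esub> h) (h x) = x"
  "h \<in> H \<Longrightarrow> x \<in> \<Omega> \<Longrightarrow> h ((inv\<^bsub>BijGroup \<Omega>\<^esub> h) x) = x"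
  by (auto simp: Bij_apply H_Bij perm_mult_apply perm_inv_apply)

lemma H_eqI: "g \<in> H \<Longrightarrow> h \<in> H \<Longrightarrow> (\<And>x. x \<in> \<Omega> \<Longrightarrow> g x = h x) \<Longrightarrow> g = h"
  using Bij_eqI H_Bij by blast

lemma inj_H [simp]: "h \<in> H \<Longrightarrow> x \<in> \<Omega> \<Longrightarrow> y \<in> \<Omega> \<Longrightarrow> h x = h y \<longleftrightarrow> x = y"
  by (rule Bij_inj[OF H_Bij])

section \<open>Normal subgroups of a permutation group\<close>

lemma inv_perm_grp: "h \<in> H \<Longrightarrow> inv\<^bsub>perm_grp \<Omega> H\<^esub> h = inv\<^bsub>BijGroup \<Omega>\<^esub> h"
  unfolding perm_grp_def by (rule group.m_inv_consistent[OF group_BijGroup subgroup_H])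

lemma subgroup_perm_grp_iff:
  "subgroup N (perm_grp \<Omega> H) \<longleftrightarrow> subgroup N (BijGroup \<Omega>) \<and> N \<subseteq> H"
proof
  assume N: "subgroup N (perm_grp \<Omega> H)"
  then show "subgroup N (BijGroup \<Omega>) \<and> N \<subseteq> H"
    using group.incl_subgroup[OF group_BijGroup subgroup_H] subgroup.subset[OF N]
    by (simp add: perm_grp_def)
next
  assume "subgroup N (BijGroup \<Omega>) \<and> N \<subseteq> H"
  then show "subgroup N (perm_grp \<Omega> H)"
    unfolding perm_grp_def using group.subgroup_incl[OF group_BijGroup _ subgroup_H] by blast
qed

lemma normal_perm_grp_iff:
  "N \<lhd> perm_grp \<Omega> H \<longleftrightarrow>
    subgroup N (BijGroup \<Omega>) \<and> N \<subseteq> H \<and> (\<forall>h\<in>H. \<forall>n\<in>N. h \<otimes>\<^bsub>BijGroup \<Omega>\<^esub> n \<otimes>\<^bsub>BijGroup \<Omega>\<^esub> inv\<^bsub>BijGroup \<Omega>\<^esub> h \<in> N)"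
  unfolding group.normal_inv_iff[OF group_perm_grp[OF subgroup_H]] subgroup_perm_grp_iff
  by (auto simp: inv_perm_grp)

lemma subgroupI_perm:
  assumes "N \<subseteq> H" "(\<lambda>x\<in>\<Omega>. x) \<in> N"
    "\<And>g h. g \<in> N \<Longrightarrow> h \<in> N \<Longrightarrow> g \<otimes>\<^bsub>BijGroup \<Omega>\<^esub> h \<in> N" "\<And>g. g \<in> N \<Longrightarrow> inv\<^bsub>BijGroup \<Omega>\<^esub> g \<in> N"
  shows "subgroup N (BijGroup \<Omega>)"
  using assms subgroup.subset[OF subgroup_H] by unfold_locales auto

text \<open>By \<open>comm\<close>, \<open>y\<close> is \<open>n h n^-1 h^-1\<close>, the product of
  \<open>n\<close> with a conjugate of \<open>n^-1\<close>. With the inverses cleared, later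
  applications can be checked by evaluation at points.\<close>

lemma normal_commutator_mem:
  assumes N: "N \<lhd> perm_grp \<Omega> H" and n: "n \<in> N" and h: "h \<in> H" and y: "y \<in> H"
    and comm: "\<And>x. x \<in> \<Omega> \<Longrightarrow> n (h x) = y (h (n x))"
  shows "y \<in> N"
proof -
  have NH: "subgroup N (BijGroup \<Omega>)" "n \<in> H"
    using N n by (auto simp: normal_perm_grp_iff)
  have "inv\<^bsub>BijGroup \<Omega>\<^esub> n \<in> N"
    by (rule subgroup.m_inv_closed[OF NH(1) n])
  then have conj: "h \<otimes>\<^bsub>BijGroup \<Omega>\<^esub> inv\<^bsub>BijGroup \<Omega>\<^esub> n \<otimes>\<^bsub>BijGroup \<Omega>\<^esub> inv\<^bsub>BijGroup \<Omega>\<^esub> h \<in> N"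
    using N h by (simp add: normal_perm_grp_iff)
  have "n \<otimes>\<^bsub>BijGroup \<Omega>\<^esub> (h \<otimes>\<^bsub>BijGroup \<Omega>\<^esub> inv\<^bsub>BijGroup \<Omega>\<^esub> n \<otimes>\<^bsub>BijGroup \<Omega>\<^esub> inv\<^bsub>BijGroup \<Omega>\<^esub> h) = y"
  proof (rule H_eqI)
    fix x assume x: "x \<in> \<Omega>"
    have "(n \<otimes>\<^bsub>BijGroup \<Omega>\<^esub> (h \<otimes>\<^bsub>BijGroup \<Omega>\<^esub> inv\<^bsub>BijGroup \<Omega>\<^esub> n \<otimes>\<^bsub>BijGroup \<Omega>\<^esub> inv\<^bsub>BijGroup \<Omega>\<^esub> h)) x = n (h ((inv\<^bsub>BijGroup \<Omega>\<^esub> n) ((inv\<^bsub>BijGroup \<Omega>\<^esub> h) x)))"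
      using NH(2) h x by simp
    also have "\<dots> = y x"
      using comm[of "(inv\<^bsub>BijGroup \<Omega>\<^esub> n) ((inv\<^bsub>BijGroup \<Omega>\<^esub> h) x)"] NH(2) h x by simp
    finally show "(n \<otimes>\<^bsub>BijGroup \<Omega>\<^esub> (h \<otimes>\<^bsub>BijGroup \<Omega>\<^esub> inv\<^bsub>BijGroup \<Omega>\<^esub> n \<otimes>\<^bsub>BijGroup \<Omega>\<^esub> inv\<^bsub>BijGroup \<Omega>\<^esub> h)) x = y x" .
  qed (use NH h y in auto)
  then show ?thesis
    using subgroup.m_closed[OF NH(1) n conj] by simp
qed

text \<open>Here \<open>y\<close> is \<open>h n h^-1\<close>, again with the inverse
  cleared.\<close>

lemma normal_conjugate_mem:
  assumes N: "N \<lhd> perm_grp \<Omega> H" and n: "n \<in> N" and h: "h \<in> H" and y: "y \<in> H"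
    and conj: "\<And>x. x \<in> \<Omega> \<Longrightarrow> y (h x) = h (n x)"
  shows "y \<in> N"
proof -
  have nH: "n \<in> H" and mem: "h \<otimes>\<^bsub>BijGroup \<Omega>\<^esub> n \<otimes>\<^bsub>BijGroup \<Omega>\<^esub> inv\<^bsub>BijGroup \<Omega>\<^esub> h \<in> N"
    using N n h by (auto simp: normal_perm_grp_iff)
  have "h \<otimes>\<^bsub>BijGroup \<Omega>\<^esub> n \<otimes>\<^bsub>BijGroup \<Omega>\<^esub> inv\<^bsub>BijGroup \<Omega>\<^esub> h = y"
  proof (rule H_eqI)
    fix x assume x: "x \<in> \<Omega>"
    then show "(h \<otimes>\<^bsub>BijGroup \<Omega>\<^esub> n \<otimes>\<^bsub>BijGroup \<Omega>\<^esub> inv\<^bsub>BijGroup \<Omega>\<^esub> h) x = y x"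
      using conj[of "(inv\<^bsub>BijGroup \<Omega>\<^esub> h) x"] nH h by simp
  qed (use nH h y in auto)
  with mem show ?thesis by simp
qed

lemma transitive_iff: "transitive_perm \<Omega> H \<longleftrightarrow> (\<forall>x\<in>\<Omega>. \<forall>y\<in>\<Omega>. \<exists>h\<in>H. h x = y)"
  by (simp add: transitive_perm_iff subgroup_H)

lemma semiregular_iff:
  "semiregular_perm \<Omega> H \<longleftrightarrow> (\<forall>h\<in>H. \<forall>x\<in>\<Omega>. h x = x \<longrightarrow> h = (\<lambda>x\<in>\<Omega>. x))"
  by (auto simp: semiregular_perm_def subgroup_H stabilizer_def)

text \<open>The kernel of the action on the classes of \<open>r\<close> is normal, and
  \<open>k\<close> with its fixed point \<open>a\<close> shows that it is not semiregular. Hence it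
  is transitive, yet each of its orbits stays inside one class.\<close>

lemma semiprimitive_class_kernel:
  assumes sp: "semiprimitive_perm \<Omega> H" and r: "equiv \<Omega> r"
    and invariant: "\<And>h x y. h \<in> H \<Longrightarrow> (x, y) \<in> r \<Longrightarrow> (h x, h y) \<in> r"
    and k: "k \<in> H" "\<And>x. x \<in> \<Omega> \<Longrightarrow> (x, k x) \<in> r"
    and point: "a \<in> \<Omega>" "k a = a" "k \<noteq> (\<lambda>x\<in>\<Omega>. x)"
    and xy: "x \<in> \<Omega>" "y \<in> \<Omega>"
  shows "(x, y) \<in> r"
proof -
  have r_refl: "(x, x) \<in> r" if "x \<in> \<Omega>" for x
    using r that by (auto elim: equivE simp: refl_on_def)
  have r_sym: "(y, x) \<in> r" if "(x, y) \<in> r" for x y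
    using r that by (auto elim: equivE dest: symD)
  have r_trans: "(x, z) \<in> r" if "(x, y) \<in> r" "(y, z) \<in> r" for x y z
    using r that by (auto elim: equivE dest: transD)
  define N where "N = {h \<in> H. \<forall>x\<in>\<Omega>. (x, h x) \<in> r}"
  have N_inv: "inv\<^bsub>BijGroup \<Omega>\<^esub> h \<in> N" if "h \<in> N" for h
    using that r_sym by (auto simp: N_def) (metis H_apply(1,4) H_closed(3))
  have N_mult: "g \<otimes>\<^bsub>BijGroup \<Omega>\<^esub> h \<in> N" if "g \<in> N" "h \<in> N" for g h
    using that by (auto simp: N_def) (meson H_apply(1) r_trans)
  have "subgroup N (BijGroup \<Omega>)"
    by (rule subgroupI_perm) (use N_inv N_mult in \<open>auto simp: N_def r_refl\<close>)
  moreover have "h \<otimes>\<^bsub>BijGroup \<Omega>\<^esub> n \<otimes>\<^bsub>BijGroup \<Omega>\<^esub> inv\<^bsub>BijGroup \<Omega>\<^esub> h \<in> N" if h: "h \<in> H" and n: "n \<in> N" for h n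
  proof -
    have "(x, h (n ((inv\<^bsub>BijGroup \<Omega>\<^esub> h) x))) \<in> r" if "x \<in> \<Omega>" for x
      using invariant[OF h, of "(inv\<^bsub>BijGroup \<Omega>\<^esub> h) x" "n ((inv\<^bsub>BijGroup \<Omega>\<^esub> h) x)"] n h that by (auto simp: N_def)
    then show ?thesis using h n by (auto simp: N_def)
  qed
  ultimately have "N \<lhd> perm_grp \<Omega> H"
    by (auto simp: normal_perm_grp_iff N_def)
  moreover have "\<not> semiregular_perm \<Omega> N"
    using k point by (auto simp: semiregular_perm_def stabilizer_def N_def)
  ultimately have "transitive_perm \<Omega> N"
    using sp by (auto simp: semiprimitive_perm_def)
  then obtain h where "h \<in> N" "h x = y"
    using xy by (auto simp: transitive_perm_iff)
  then show ?thesis using xy by (auto simp: N_def)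
qed

section \<open>Orbit relations of normal subgroups\<close>

definition orbit_rel :: "('a \<Rightarrow> 'a) set \<Rightarrow> ('a \<times> 'a) set"
  where "orbit_rel D = {(x, d x) | x d. x \<in> \<Omega> \<and> d \<in> D}"

lemma equiv_orbit_rel:
  assumes "subgroup D (BijGroup \<Omega>)"
  shows "equiv \<Omega> (orbit_rel D)"
proof -
  interpret D: perm_group \<Omega> D by (rule perm_group.intro[OF assms])
  show ?thesis
  proof (rule equivI)
    show "refl_on \<Omega> (orbit_rel D)"
      by (auto simp: refl_on_def orbit_rel_def) (metis D.H_closed(1) restrict_apply')
    show "sym (orbit_rel D)"
      by (auto simp: sym_def orbit_rel_def) (metis D.H_apply(1,3) D.H_closed(3))
    show "trans (orbit_rel D)"
      by (auto simp: trans_def orbit_rel_def) (metis D.H_apply(2) D.H_closed(2))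
  qed (auto simp: orbit_rel_def)
qed

text \<open>If \<open>y = d x\<close>, then \<open>h y = (h d h^-1) (h x)\<close>, and normality
  puts the conjugate in \<open>D\<close>.\<close>

lemma orbit_rel_invariant:
  assumes D: "D \<lhd> perm_grp \<Omega> H" and h: "h \<in> H" and xy: "(x, y) \<in> orbit_rel D"
  shows "(h x, h y) \<in> orbit_rel D"
proof -
  obtain d where d: "d \<in> D" "y = d x" and x: "x \<in> \<Omega>" using xy by (auto simp: orbit_rel_def)
  have "d \<in> H" and conj: "h \<otimes>\<^bsub>BijGroup \<Omega>\<^esub> d \<otimes>\<^bsub>BijGroup \<Omega>\<^esub> inv\<^bsub>BijGroup \<Omega>\<^esub> h \<in> D"
    using D d h by (auto simp: normal_perm_grp_iff)
  then have "h y = (h \<otimes>\<^bsub>BijGroup \<Omega>\<^esub> d \<otimes>\<^bsub>BijGroup \<Omega>\<^esub> inv\<^bsub>BijGroup \<Omega>\<^esub> h) (h x)"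
    using d x h by simp
  then show ?thesis using conj h x by (auto simp: orbit_rel_def)
qed

lemma transitive_of_orbit_rel:
  assumes "subgroup D (BijGroup \<Omega>)" "\<And>x y. x \<in> \<Omega> \<Longrightarrow> y \<in> \<Omega> \<Longrightarrow> (x, y) \<in> orbit_rel D"
  shows "transitive_perm \<Omega> D"
  using assms by (force simp: transitive_perm_iff orbit_rel_def)

text \<open>Modulo \<open>D\<close> the element \<open>x\<close> is central, so it treats every
  point like its fixed point \<open>a\<close> and maps each \<open>D\<close>-orbit to itself. Then
  \<open>semiprimitive_class_kernel\<close> leaves room for only one \<open>D\<close>-orbit.\<close>

lemma semiprimitive_commutators_transitive:
  assumes sp: "semiprimitive_perm \<Omega> H" and D: "D \<lhd> perm_grp \<Omega> H"
    and x: "x \<in> H" "a \<in> \<Omega>" "x a = a" "x \<noteq> (\<lambda>x\<in>\<Omega>. x)"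
    and comm: "\<And>y. y \<in> H \<Longrightarrow> commutator \<Omega> x y \<in> D"
  shows "transitive_perm \<Omega> D"
proof (rule transitive_of_orbit_rel)
  show D_sub: "subgroup D (BijGroup \<Omega>)" using D by (simp add: normal_perm_grp_iff)
  have x_r: "(b, x b) \<in> orbit_rel D" if b: "b \<in> \<Omega>" for b
  proof -
    obtain m where m: "m \<in> H" "b = m a"
      using sp b x(2) by (metis semiprimitive_perm_def transitive_iff)
    have "(inv\<^bsub>BijGroup \<Omega>\<^esub> x) a = a" using H_apply(3)[OF x(1,2)] x(3) by simp
    \<comment> \<open>Since \<open>m^-1\<close> sends \<open>b\<close> to \<open>a\<close>, which
      \<open>x^-1\<close> fixes, \<open>m x^-1 m^-1\<close> fixes \<open>b\<close>.\<close>
    then have "x b = commutator \<Omega> x m b"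
      using m x by simp
    then show ?thesis using comm[OF m(1)] b by (auto simp: orbit_rel_def)
  qed
  show "(b, c) \<in> orbit_rel D" if "b \<in> \<Omega>" "c \<in> \<Omega>" for b c
    by (rule semiprimitive_class_kernel[OF sp equiv_orbit_rel[OF D_sub]])
      (fact orbit_rel_invariant[OF D] x_r x that)+
qed

text \<open>The derived subgroup is the least subgroup containing all commutators, and for perfect
  \<open>H\<close> it is \<open>H\<close> itself.\<close>

lemma perfect_subset_of_commutators:
  assumes perfect: "perfect_perm \<Omega> H" and D: "D \<lhd> perm_grp \<Omega> H"
    and comm: "\<And>x y. x \<in> H \<Longrightarrow> y \<in> H \<Longrightarrow> commutator \<Omega> x y \<in> D"
  shows "H \<subseteq> D"
proof -
  have "derived (perm_grp \<Omega> H) H \<subseteq> D"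
    unfolding derived_def
    by (rule group.generate_subgroup_incl[OF group_perm_grp[OF subgroup_H] _ normal_imp_subgroup[OF D]])
      (auto simp: inv_perm_grp comm)
  then show ?thesis using perfect by (simp add: perfect_perm_def)
qed

text \<open>With the action axioms supplied by \<open>restrict_orbit_action\<close>, faithfulness is
  injectivity of the restriction to an orbit, which for a homomorphism means a trivial
  kernel.\<close>

lemma faithful_on_orbits_iff:
  "faithful_on_orbits \<Omega> H \<longleftrightarrow>
    (\<forall>x\<in>\<Omega>. \<forall>g\<in>H. (\<forall>h\<in>H. g (h x) = h x) \<longrightarrow> g = (\<lambda>x\<in>\<Omega>. x))"
  (is "_ = ?rhs")
proof -
  let ?orb = "\<lambda>x. {h x | h. h \<in> H}"
  have orb: "orbits (perm_grp \<Omega> H) \<Omega> (\<lambda>h. h) = ?orb ` \<Omega>"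
    by (auto simp: orbits_def orbit_def)
  have "faithful_on_orbits \<Omega> H \<longleftrightarrow> (\<forall>x\<in>\<Omega>. inj_on (\<lambda>h. restrict h (?orb x)) H)"
    using restrict_orbit_action[OF subgroup_H] unfolding orb
    by (auto simp: faithful_on_orbits_def orb faithful_action_def faithful_action_axioms_def)
  also have "\<dots> \<longleftrightarrow> ?rhs"
  proof (intro ball_cong refl iffI ballI impI)
    fix x g assume x: "x \<in> \<Omega>" and inj: "inj_on (\<lambda>h. restrict h (?orb x)) H"
      and g: "g \<in> H" "\<forall>h\<in>H. g (h x) = h x"
    have "restrict g (?orb x) = restrict (\<lambda>x\<in>\<Omega>. x) (?orb x)"
      using g x by (auto simp: fun_eq_iff restrict_def)
    then show "g = (\<lambda>x\<in>\<Omega>. x)"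
      using inj_onD[OF inj] g by blast
  next
    fix x assume x: "x \<in> \<Omega>"
      and triv: "\<forall>g\<in>H. (\<forall>h\<in>H. g (h x) = h x) \<longrightarrow> g = (\<lambda>x\<in>\<Omega>. x)"
    show "inj_on (\<lambda>h. restrict h (?orb x)) H"
    proof (rule inj_onI)
      fix g k assume g: "g \<in> H" and k: "k \<in> H"
        and eq: "restrict g (?orb x) = restrict k (?orb x)"
      have "g (h x) = k (h x)" if "h \<in> H" for h
        using fun_cong[OF eq, of "h x"] that by (auto simp: restrict_def split: if_splits)
      \<comment> \<open>Two elements that agree on the orbit differ by an element fixing it
        pointwise.\<close>
      then have "(inv\<^bsub>BijGroup \<Omega>\<^esub> k \<otimes>\<^bsub>BijGroup \<Omega>\<^esub> g) (h x) = h x" if "h \<in> H" for h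
        using that g k x by simp
      then have one: "inv\<^bsub>BijGroup \<Omega>\<^esub> k \<otimes>\<^bsub>BijGroup \<Omega>\<^esub> g = (\<lambda>x\<in>\<Omega>. x)"
        using triv g k by auto
      show "g = k"
      proof (rule H_eqI[OF g k])
        fix y assume y: "y \<in> \<Omega>"
        have "(inv\<^bsub>BijGroup \<Omega>\<^esub> k) (g y) = y"
          using fun_cong[OF one, of y] y g k by simp
        then show "g y = k y"
          using H_apply(4)[OF k, of "g y"] y g by simp
      qed
    qed
  qed
  finally show ?thesis .
qed

end

subsection \<open>The product action\<close>

locale wreath_product_action =
  fixes \<Delta> :: "'d set" and I :: "'i set"
    and M :: "('d \<Rightarrow> 'd) set" and T :: "('i \<Rightarrow> 'i) set" and \<delta> :: 'd
  assumes subgroup_M: "subgroup M (BijGroup \<Delta>)" and subgroup_T: "subgroup T (BijGroup I)"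
    and \<delta>: "\<delta> \<in> \<Delta>"
begin

abbreviation R where "R \<equiv> res_pow I \<Delta> \<delta>"
abbreviation G where "G \<equiv> res_wreath I \<Delta> \<delta> M T"

sublocale M: perm_group \<Delta> M by (rule perm_group.intro[OF subgroup_M])
sublocale T: perm_group I T by (rule perm_group.intro[OF subgroup_T])
sublocale G: perm_group R G
  by (rule perm_group.intro[OF subgroup_res_wreath[OF subgroup_M subgroup_T \<delta>]])

text \<open>For \<open>i \<in> I\<close> this is the embedding of \<open>M\<close> as the
  \<open>i\<close>-th direct factor of the base group.\<close>

definition coord :: "'i \<Rightarrow> ('d \<Rightarrow> 'd) \<Rightarrow> ('i \<Rightarrow> 'd) \<Rightarrow> ('i \<Rightarrow> 'd)"
  where "coord i m = base_perm I \<Delta> \<delta> (\<lambda>j. if j = i then m else (\<lambda>x\<in>\<Delta>. x))"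

section \<open>Points of the restricted power and generators of the wreath product\<close>

lemma R_apply [simp]: "f \<in> R \<Longrightarrow> i \<in> I \<Longrightarrow> f i \<in> \<Delta>"
  by (auto simp: res_pow_def)

lemma R_eqI: "f \<in> R \<Longrightarrow> g \<in> R \<Longrightarrow> (\<And>i. i \<in> I \<Longrightarrow> f i = g i) \<Longrightarrow> f = g"
  by (auto simp: res_pow_def intro: PiE_ext)

lemma R_finite: "f \<in> R \<Longrightarrow> finite {i \<in> I. f i \<noteq> \<delta>}"
  by (simp add: res_pow_def)

lemma const_R [simp]: "(\<lambda>i\<in>I. \<delta>) \<in> R"
  by (simp add: res_pow_def \<delta>)

lemma upd_R [simp]:
  assumes "f \<in> R" "i \<in> I" "a \<in> \<Delta>"
  shows "f(i := a) \<in> R"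
proof -
  have "{j \<in> I. (f(i := a)) j \<noteq> \<delta>} \<subseteq> insert i {j \<in> I. f j \<noteq> \<delta>}" by auto
  moreover have "finite (insert i {j \<in> I. f j \<noteq> \<delta>})"
    using R_finite[OF assms(1)] by simp
  ultimately have "finite {j \<in> I. (f(i := a)) j \<noteq> \<delta>}"
    by (rule finite_subset)
  moreover have "f(i := a) \<in> insert i I \<rightarrow>\<^sub>E \<Delta>"
    using assms by (intro PiE_fun_upd) (simp_all add: res_pow_def)
  ultimately show ?thesis
    using assms(2) by (simp add: res_pow_def insert_absorb)
qed

text \<open>Elements of the carrier of \<open>sum_group\<close> are extensional; this allows
  component functions with arbitrary values off \<open>I\<close>, as in
  \<open>coord\<close>.\<close>

lemma base_perm_restrict: "base_perm I \<Delta> \<delta> (restrict h I) = base_perm I \<Delta> \<delta> h"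
  by (auto simp: base_perm_def fun_eq_iff restrict_def)

lemma base_perm_mem:
  assumes "\<And>i. i \<in> I \<Longrightarrow> h i \<in> M" "finite {i \<in> I. h i \<noteq> (\<lambda>x\<in>\<Delta>. x)}"
  shows "base_perm I \<Delta> \<delta> h \<in> G"
proof -
  have "{i \<in> I. restrict h I i \<noteq> (\<lambda>x\<in>\<Delta>. x)} = {i \<in> I. h i \<noteq> (\<lambda>x\<in>\<Delta>. x)}" by auto
  then have "restrict h I \<in> carrier (sum_group I (\<lambda>_. perm_grp \<Delta> M))"
    using assms by (simp add: carrier_sum_group group_perm_grp[OF subgroup_M])
  then show ?thesis
    unfolding res_wreath_def base_perm_restrict[of h, symmetric] by (blast intro: generate.incl)
qed

lemma top_perm_mem [simp]: "t \<in> T \<Longrightarrow> top_perm I \<Delta> \<delta> t \<in> G"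
  unfolding res_wreath_def by (blast intro: generate.incl)

lemma coord_mem [simp]: "m \<in> M \<Longrightarrow> coord i m \<in> G"
  unfolding coord_def by (rule base_perm_mem) (auto intro: finite_subset[of _ "{i}"])

lemma base_perm_apply [simp]: "f \<in> R \<Longrightarrow> i \<in> I \<Longrightarrow> base_perm I \<Delta> \<delta> h f i = h i (f i)"
  by (simp add: base_perm_def)

lemma top_perm_apply [simp]:
  "f \<in> R \<Longrightarrow> t \<in> T \<Longrightarrow> i \<in> I \<Longrightarrow> top_perm I \<Delta> \<delta> t f (t i) = f i"
  by (simp add: top_perm_def)

lemma coord_apply [simp]:
  assumes "m \<in> M" "i \<in> I" "f \<in> R"
  shows "coord i m f = f(i := m (f i))"
  using assms G.H_apply(1)[OF coord_mem[OF assms(1)] assms(3), of i]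
  by (intro R_eqI) (auto simp: coord_def)

lemma T_surj:
  assumes "t \<in> T" "i \<in> I"
  obtains j where "j \<in> I" "i = t j"
proof
  show "(inv\<^bsub>BijGroup I\<^esub> t) i \<in> I" "i = t ((inv\<^bsub>BijGroup I\<^esub> t) i)"
    using assms by simp_all
qed

text \<open>As \<open>t\<close> maps onto \<open>I\<close>, it suffices to compare at the positions
  \<open>t i\<close>, where the formulas contain no inverse of \<open>t\<close>.\<close>

lemma R_eqI_top:
  assumes t: "t \<in> T" and "f \<in> R" "g \<in> R" and eq: "\<And>i. i \<in> I \<Longrightarrow> f (t i) = g (t i)"
  shows "f = g"
proof (rule R_eqI)
  fix i assume "i \<in> I"
  then obtain j where "j \<in> I" "i = t j" using T_surj t by blast
  then show "f i = g i" using eq by simp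
qed (fact assms)+

text \<open>
  Writing \<open>h i\<close> for the action on the \<open>i\<close>-th coordinate before it is moved to position \<open>t i\<close> keeps
  inverses out of the formula.
\<close>

definition acts_as :: "(('i \<Rightarrow> 'd) \<Rightarrow> ('i \<Rightarrow> 'd)) \<Rightarrow> ('i \<Rightarrow> 'd \<Rightarrow> 'd) \<Rightarrow> ('i \<Rightarrow> 'i) \<Rightarrow> bool"
  where "acts_as g h t \<longleftrightarrow> h \<in> I \<rightarrow> M \<and> t \<in> T \<and> (\<forall>f\<in>R. \<forall>i\<in>I. g f (t i) = h i (f i))"

lemma acts_as_base: "h \<in> I \<rightarrow> M \<Longrightarrow> acts_as (base_perm I \<Delta> \<delta> h) h (\<lambda>i\<in>I. i)"
  by (simp add: acts_as_def)

lemma acts_as_top: "t \<in> T \<Longrightarrow> acts_as (top_perm I \<Delta> \<delta> t) (\<lambda>i. (\<lambda>x\<in>\<Delta>. x)) t"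
  by (simp add: acts_as_def)

lemma acts_as_one: "acts_as (\<lambda>f\<in>R. f) (\<lambda>i. (\<lambda>x\<in>\<Delta>. x)) (\<lambda>i\<in>I. i)"
  by (simp add: acts_as_def)

text \<open>Put \<open>f' = g^-1 f\<close> and read \<open>g f' = f\<close> at position
  \<open>i = t (s i)\<close>: it gives \<open>f i = h (s i) (f' (s i))\<close>, which is solved for
  \<open>f' (s i)\<close>.\<close>

lemma acts_as_inv:
  assumes g: "g \<in> G" and form: "acts_as g h t"
  shows "acts_as (inv\<^bsub>BijGroup R\<^esub> g)
    (\<lambda>j. inv\<^bsub>BijGroup \<Delta>\<^esub> (h ((inv\<^bsub>BijGroup I\<^esub> t) j))) (inv\<^bsub>BijGroup I\<^esub> t)"
proof -
  define s where "s = inv\<^bsub>BijGroup I\<^esub> t"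
  have h: "h i \<in> M" if "i \<in> I" for i using form that by (auto simp: acts_as_def)
  have t: "t \<in> T" "s \<in> T" using form by (auto simp: acts_as_def s_def)
  have "(inv\<^bsub>BijGroup R\<^esub> g) f (s i) = (inv\<^bsub>BijGroup \<Delta>\<^esub> (h (s i))) (f i)"
    if f: "f \<in> R" and i: "i \<in> I" for f i
  proof -
    define f' where "f' = (inv\<^bsub>BijGroup R\<^esub> g) f"
    have f': "f' \<in> R" "g f' = f" using f g by (simp_all add: f'_def)
    have si: "s i \<in> I" "t (s i) = i" using i t by (simp_all add: s_def)
    have "f i = h (s i) (f' (s i))"
      using form f' si by (force simp: acts_as_def)
    then show ?thesis
      using f' si h[OF si(1)] by (simp add: f'_def[symmetric])
  qed
  then show ?thesis using t h by (simp add: acts_as_def s_def)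
qed

text \<open>The entry at \<open>i\<close> is changed by \<open>h2 i\<close> and carried to
  \<open>t2 i\<close>, where \<open>g1\<close> changes it by \<open>h1 (t2 i)\<close> and carries it
  on.\<close>

lemma acts_as_mult:
  assumes g: "g1 \<in> G" "g2 \<in> G" and form: "acts_as g1 h1 t1" "acts_as g2 h2 t2"
  shows "acts_as (g1 \<otimes>\<^bsub>BijGroup R\<^esub> g2) (\<lambda>i. h1 (t2 i) \<otimes>\<^bsub>BijGroup \<Delta>\<^esub> h2 i) (t1 \<otimes>\<^bsub>BijGroup I\<^esub> t2)"
proof -
  have t: "t1 \<in> T" "t2 \<in> T" using form by (auto simp: acts_as_def)
  have h: "h1 (t2 i) \<in> M" "h2 i \<in> M" if "i \<in> I" for i
    using form that t by (auto simp: acts_as_def Pi_iff)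
  have "g1 (g2 f) (t1 (t2 i)) = h1 (t2 i) (h2 i (f i))" if "f \<in> R" "i \<in> I" for f i
    using form g t that by (simp add: acts_as_def)
  then show ?thesis using g t h by (simp add: acts_as_def)
qed

text \<open>Generators act in this way, and the form survives products and inverses. Finite support
  of \<open>h\<close> is not recorded; \<open>perfect_M\<close> recovers the finiteness it uses from
  the image of the constant point.\<close>

lemma G_form:
  assumes "g \<in> G"
  obtains h t where "h \<in> I \<rightarrow> M" "t \<in> T" "\<And>f i. f \<in> R \<Longrightarrow> i \<in> I \<Longrightarrow> g f (t i) = h i (f i)"
proof -
  let ?S = "base_perm I \<Delta> \<delta> ` carrier (sum_group I (\<lambda>_. perm_grp \<Delta> M)) \<union> top_perm I \<Delta> \<delta> ` T"
  have gens: "\<exists>h t. acts_as g h t" if "g \<in> ?S" for g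
    using that
  proof
    assume "g \<in> base_perm I \<Delta> \<delta> ` carrier (sum_group I (\<lambda>_. perm_grp \<Delta> M))"
    then obtain h where "h \<in> I \<rightarrow> M" "g = base_perm I \<Delta> \<delta> h"
      by (auto simp: carrier_sum_group group_perm_grp[OF subgroup_M])
    then show ?thesis using acts_as_base by blast
  next
    assume "g \<in> top_perm I \<Delta> \<delta> ` T"
    then show ?thesis using acts_as_top by blast
  qed
  have G: "g \<in> G \<longleftrightarrow> g \<in> generate (BijGroup R) ?S" for g
    by (simp add: res_wreath_def)
  have "\<exists>h t. acts_as g h t" using assms unfolding G
  proof (induction rule: generate.induct)
    case one
    show ?case unfolding one_BijGroup using acts_as_one by blast
  next
    case (incl g)
    then show ?case by (rule gens)
  next
    case (inv g)
    obtain h t where "acts_as g h t" using gens[OF inv] by blast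
    moreover have "g \<in> G" unfolding G using inv by (rule generate.incl)
    ultimately show ?case using acts_as_inv by blast
  next
    case (eng g1 g2)
    obtain h1 t1 h2 t2 where "acts_as g1 h1 t1" "acts_as g2 h2 t2" using eng.IH by blast
    then show ?case using acts_as_mult eng.hyps unfolding G[symmetric] by blast
  qed
  then show ?thesis using that by (auto simp: acts_as_def)
qed

text \<open>The commutator of \<open>n\<close> with \<open>coord i y\<close> is trivial off
  \<open>i\<close>, because \<open>n\<close> moves no coordinate.\<close>

lemma commutator_coord_mem:
  assumes N: "N \<lhd> perm_grp R G" and n: "n \<in> N" and h: "h i \<in> M"
    and form: "\<And>f j. f \<in> R \<Longrightarrow> j \<in> I \<Longrightarrow> n f j = h j (f j)"
    and i: "i \<in> I" and y: "y \<in> M"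
  shows "coord i (commutator \<Delta> (h i) y) \<in> N"
proof (rule G.normal_commutator_mem[OF N n])
  fix f assume f: "f \<in> R"
  have nG: "n \<in> G" using N n by (auto simp: G.normal_perm_grp_iff)
  show "n (coord i y f) = coord i (commutator \<Delta> (h i) y) (coord i y (n f))"
    by (rule R_eqI) (use f nG h i y in \<open>auto simp: form\<close>)
qed (use h y in auto)

text \<open>Since \<open>n\<close> carries \<open>i\<close> elsewhere, the commutator of
  \<open>n\<close> with an element supported on \<open>i\<close> has two separate components, and
  the one at \<open>i\<close> can be made any \<open>m\<close>.\<close>

lemma moved_commutator_mem:
  assumes N: "N \<lhd> perm_grp R G" and n: "n \<in> N" and h: "h \<in> I \<rightarrow> M" and t: "t \<in> T"
    and form: "\<And>f j. f \<in> R \<Longrightarrow> j \<in> I \<Longrightarrow> n f (t j) = h j (f j)"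
    and i: "i \<in> I" "t i \<noteq> i" and m: "m \<in> M" and y: "y \<in> M"
  shows "coord i (commutator \<Delta> m y) \<in> N"
proof -
  have nG: "n \<in> G" using N n by (auto simp: G.normal_perm_grp_iff)
  have hi: "h i \<in> M" using h i by auto
  \<comment> \<open>This is the commutator of \<open>n\<close> with \<open>coord i (m^-1)\<close>:
    the final inverse leaves \<open>m\<close> at \<open>i\<close>, and conjugation by
    \<open>n\<close> puts a conjugate of \<open>m^-1\<close> at \<open>t i\<close>.\<close>
  define k where "k = (\<lambda>j. if j = i then m
    else if j = t i then h i \<otimes>\<^bsub>BijGroup \<Delta>\<^esub> inv\<^bsub>BijGroup \<Delta>\<^esub> m \<otimes>\<^bsub>BijGroup \<Delta>\<^esub> inv\<^bsub>BijGroup \<Delta>\<^esub> (h i) else (\<lambda>x\<in>\<Delta>. x))"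
  have kM: "k j \<in> M" for j using m hi by (simp add: k_def)
  have k_mem: "base_perm I \<Delta> \<delta> k \<in> G"
    by (rule base_perm_mem[OF kM]) (auto intro: finite_subset[of _ "{i, t i}"] simp: k_def)
  have "base_perm I \<Delta> \<delta> k \<in> N"
  proof (rule G.normal_commutator_mem[OF N n _ k_mem])
    let ?x = "coord i (inv\<^bsub>BijGroup \<Delta>\<^esub> m)"
    show "?x \<in> G" using m by simp
    fix f assume f: "f \<in> R"
    show "n (?x f) = base_perm I \<Delta> \<delta> k (?x (n f))"
    proof (rule R_eqI_top[OF t])
      have nf: "n f \<in> R" "?x f \<in> R" "?x (n f) \<in> R" using nG f m i by simp_all
      then show "n (?x f) \<in> R" "base_perm I \<Delta> \<delta> k (?x (n f)) \<in> R"
        using nG k_mem by simp_all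
      fix j assume j: "j \<in> I"
      have tj: "t j = t i \<longleftrightarrow> j = i" "t j \<in> I" "h j \<in> M" using t i j h by auto
      have fj: "f j \<in> \<Delta>" "f i \<in> \<Delta>" "h j (f j) \<in> \<Delta>" "n f i \<in> \<Delta>"
        using f i j tj nf by simp_all
      have lhs: "n (?x f) (t j) = h j (?x f j)" by (rule form[OF nf(2) j])
      have rhs: "base_perm I \<Delta> \<delta> k (?x (n f)) (t j) = k (t j) (?x (n f) (t j))"
        using nf tj by simp
      have ntj: "n f (t j) = h j (f j)" by (rule form[OF f j])
      show "n (?x f) (t j) = base_perm I \<Delta> \<delta> k (?x (n f)) (t j)"
        unfolding lhs rhs using f nf i m hi j tj fj ntj by (auto simp: k_def)
    qed
  qed
  \<comment> \<open>A second commutator, with \<open>coord i y\<close>, discards the component at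
    \<open>t i\<close>.\<close>
  then have "coord i (commutator \<Delta> (k i) y) \<in> N"
    by (rule commutator_coord_mem[OF N _ kM _ i(1) y]) simp
  then show ?thesis by (simp add: k_def)
qed

text \<open>Conjugation by \<open>top_perm I \<Delta> \<delta> t\<close> carries the
  \<open>i\<close>-th factor of the base group to the factor at \<open>t i\<close>.\<close>

lemma coord_conj_top:
  assumes N: "N \<lhd> perm_grp R G" and mem: "coord i m \<in> N" and m: "m \<in> M" and t: "t \<in> T"
    and i: "i \<in> I"
  shows "coord (t i) m \<in> N"
proof (rule G.normal_conjugate_mem[OF N mem])
  fix f assume f: "f \<in> R"
  have *: "top_perm I \<Delta> \<delta> t f \<in> R" using f t by simp
  show "coord (t i) m (top_perm I \<Delta> \<delta> t f) = top_perm I \<Delta> \<delta> t (coord i m f)"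
    by (rule R_eqI_top[OF t]) (use f t i m * in auto)
qed (use t m in auto)

section \<open>The coordinate embeddings as homomorphisms\<close>

lemma coord_mult:
  assumes "m \<in> M" "k \<in> M" "i \<in> I"
  shows "coord i (m \<otimes>\<^bsub>BijGroup \<Delta>\<^esub> k) = coord i m \<otimes>\<^bsub>BijGroup R\<^esub> coord i k"
  by (rule G.H_eqI) (use assms in auto)

lemma coord_one: "i \<in> I \<Longrightarrow> coord i (\<lambda>x\<in>\<Delta>. x) = (\<lambda>f\<in>R. f)"
  by (rule G.H_eqI) auto

lemma coord_inv:
  assumes "m \<in> M" "i \<in> I"
  shows "coord i (inv\<^bsub>BijGroup \<Delta>\<^esub> m) = inv\<^bsub>BijGroup R\<^esub> (coord i m)"
proof (rule G.H_eqI)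
  fix f assume f: "f \<in> R"
  have "coord i m (coord i (inv\<^bsub>BijGroup \<Delta>\<^esub> m) f) = f"
    using assms f by simp
  then show "coord i (inv\<^bsub>BijGroup \<Delta>\<^esub> m) f = (inv\<^bsub>BijGroup R\<^esub> (coord i m)) f"
    using assms f by (metis G.H_apply(1,3) M.H_closed(3) coord_mem)
qed (use assms in auto)

text \<open>This is the preimage of a normal subgroup under the homomorphism
  \<open>coord i\<close>.\<close>

lemma coord_vimage_normal:
  assumes N: "N \<lhd> perm_grp R G" and i: "i \<in> I"
  shows "{m \<in> M. coord i m \<in> N} \<lhd> perm_grp \<Delta> M"
proof -
  have subgroup_N: "subgroup N (BijGroup R)" and NG: "N \<subseteq> G"
    and conj: "\<And>h n. h \<in> G \<Longrightarrow> n \<in> N \<Longrightarrow>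
      h \<otimes>\<^bsub>BijGroup R\<^esub> n \<otimes>\<^bsub>BijGroup R\<^esub> inv\<^bsub>BijGroup R\<^esub> h \<in> N"
    using N by (auto simp: G.normal_perm_grp_iff)
  interpret N: perm_group R N by (rule perm_group.intro[OF subgroup_N])
  have "subgroup {m \<in> M. coord i m \<in> N} (BijGroup \<Delta>)"
    by (rule M.subgroupI_perm) (use i in \<open>auto simp: coord_mult coord_inv coord_one\<close>)
  then show ?thesis
    using i conj by (auto simp: M.normal_perm_grp_iff coord_mult coord_inv)
qed

text \<open>Two points of \<open>R\<close> differ in finitely many coordinates only, so they can be
  matched one coordinate at a time.\<close>

lemma transitive_of_coords:
  assumes N: "subgroup N (BijGroup R)"
    and coords: "\<And>i a b. i \<in> I \<Longrightarrow> a \<in> \<Delta> \<Longrightarrow> b \<in> \<Delta> \<Longrightarrow> \<exists>m\<in>M. m a = b \<and> coord i m \<in> N"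
  shows "transitive_perm R N"
proof -
  interpret N: perm_group R N by (rule perm_group.intro[OF N])
  \<comment> \<open>The set \<open>F\<close> bounds the coordinates where \<open>f\<close> and
    \<open>g\<close> may differ. Each induction step corrects one entry of \<open>f\<close>, so
    \<open>f\<close> is kept arbitrary.\<close>
  have step: "\<exists>n\<in>N. n f = g"
    if "finite F" "f \<in> R" "g \<in> R" "\<And>i. i \<in> I - F \<Longrightarrow> f i = g i" for F f g
    using that
  proof (induction F arbitrary: f rule: finite_induct)
    case empty
    then have "f = g" by (auto intro: R_eqI)
    then show ?case using empty by (intro bexI[of _ "\<lambda>f\<in>R. f"]) auto
  next
    case (insert i F)
    show ?case
    proof (cases "i \<in> I")
      case True
      obtain m where m: "m \<in> M" "m (f i) = g i" "coord i m \<in> N"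
        using coords[OF True, of "f i" "g i"] insert.prems True by auto
      have upd: "coord i m f = f(i := g i)"
        using m insert.prems(1) True by simp
      have "\<exists>n\<in>N. n (coord i m f) = g"
      proof (rule insert.IH)
        show "coord i m f \<in> R" using m insert.prems(1) by simp
        show "coord i m f j = g j" if "j \<in> I - F" for j
          using that insert.prems(3)[of j] by (cases "j = i") (simp_all add: upd)
      qed (fact insert.prems)
      then obtain n where "n \<in> N" "n (coord i m f) = g" by blast
      then show ?thesis
        using m(3) insert.prems(1) by (intro bexI[of _ "n \<otimes>\<^bsub>BijGroup R\<^esub> coord i m"]) auto
    next
      case False
      then show ?thesis using insert by auto
    qed
  qed
  have "\<exists>n\<in>N. n f = g" if "f \<in> R" "g \<in> R" for f g
  proof (rule step)
    show "finite ({i \<in> I. f i \<noteq> \<delta>} \<union> {i \<in> I. g i \<noteq> \<delta>})"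
      using that by (simp add: R_finite)
  qed (use that in auto)
  then show ?thesis by (simp add: N.transitive_iff)
qed

subsection \<open>Sufficiency\<close>

lemma transitive_G: "transitive_perm \<Delta> M \<Longrightarrow> transitive_perm R G"
  by (rule transitive_of_coords[OF G.subgroup_H]) (auto simp: M.transitive_iff)

lemma coord_eq_one_iff:
  assumes m: "m \<in> M" and i: "i \<in> I"
  shows "coord i m = (\<lambda>f\<in>R. f) \<longleftrightarrow> m = (\<lambda>x\<in>\<Delta>. x)"
proof
  assume eq: "coord i m = (\<lambda>f\<in>R. f)"
  show "m = (\<lambda>x\<in>\<Delta>. x)"
  proof (rule M.H_eqI[OF m])
    fix x assume x: "x \<in> \<Delta>"
    have "coord i m ((\<lambda>i\<in>I. \<delta>)(i := x)) i = ((\<lambda>i\<in>I. \<delta>)(i := x)) i"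
      using eq x i by simp
    then show "m x = (\<lambda>x\<in>\<Delta>. x) x" using m i x by simp
  qed simp
qed (simp add: coord_one i)

text \<open>This provides the fixed point that \<open>semiprimitive_class_kernel\<close> asks of an
  element of \<open>T\<close>.\<close>

lemma top_perm_const: "t \<in> T \<Longrightarrow> top_perm I \<Delta> \<delta> t (\<lambda>i\<in>I. \<delta>) = (\<lambda>i\<in>I. \<delta>)"
  by (rule R_eqI_top[of t]) auto

text \<open>A second point \<open>a\<close> makes \<open>T\<close> faithful on \<open>R\<close>:
  placed at a coordinate \<open>i\<close> moved by \<open>t\<close>, it turns up at
  \<open>t i\<close>, where the original point has \<open>\<delta>\<close>.\<close>

lemma top_perm_ne_one:
  assumes t: "t \<in> T" "t \<noteq> (\<lambda>i\<in>I. i)" and a: "a \<in> \<Delta>" "a \<noteq> \<delta>"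
  shows "top_perm I \<Delta> \<delta> t \<noteq> (\<lambda>f\<in>R. f)"
proof
  assume eq: "top_perm I \<Delta> \<delta> t = (\<lambda>f\<in>R. f)"
  obtain i where i: "i \<in> I" "t i \<noteq> i"
    using t T.H_eqI[of t "\<lambda>i\<in>I. i"] by auto
  have "top_perm I \<Delta> \<delta> t ((\<lambda>i\<in>I. \<delta>)(i := a)) (t i) = \<delta>"
    unfolding eq using i a t by simp
  then show False using i a t by simp
qed

text \<open>For \<open>N\<close> not semiregular, it suffices to find one coordinate where the
  preimage of \<open>N\<close> in \<open>M\<close> is transitive; transitivity of \<open>T\<close>
  spreads this to all coordinates.\<close>

lemma semiprimitive_G_nonregular:
  assumes sp: "semiprimitive_perm \<Delta> M" and nr: "\<not> regular_perm \<Delta> M"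
    and tr: "transitive_perm I T"
  shows "semiprimitive_perm R G"
  unfolding semiprimitive_perm_def
proof (intro conjI allI impI)
  have trM: "transitive_perm \<Delta> M" using sp by (simp add: semiprimitive_perm_def)
  then show "transitive_perm R G" by (rule transitive_G)
  fix N assume N: "N \<lhd> perm_grp R G"
  have N_sub: "subgroup N (BijGroup R)" and NG: "N \<subseteq> G"
    using N by (auto simp: G.normal_perm_grp_iff)
  interpret N: perm_group R N by (rule perm_group.intro[OF N_sub])
  have "transitive_perm R N" if "\<not> semiregular_perm R N"
  proof -
    obtain n f where n: "n \<in> N" "n \<noteq> (\<lambda>f\<in>R. f)" and f: "f \<in> R" "n f = f"
      using \<open>\<not> semiregular_perm R N\<close> by (auto simp: N.semiregular_iff)
    obtain h t where h: "h \<in> I \<rightarrow> M" and t: "t \<in> T"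
      and form: "\<And>f i. f \<in> R \<Longrightarrow> i \<in> I \<Longrightarrow> n f (t i) = h i (f i)"
      using G_form n NG by blast
    \<comment> \<open>These are the data required by
      \<open>semiprimitive_commutators_transitive\<close>.\<close>
    have "\<exists>i\<in>I. \<exists>m\<in>M. \<exists>a\<in>\<Delta>. m a = a \<and> m \<noteq> (\<lambda>x\<in>\<Delta>. x) \<and>
        (\<forall>y\<in>M. coord i (commutator \<Delta> m y) \<in> N)"
    proof (cases "\<forall>i\<in>I. t i = i")
      case True
      then have diag: "n f i = h i (f i)" if "f \<in> R" "i \<in> I" for f i
        using form[OF that] that by simp
      have "\<exists>i\<in>I. h i \<noteq> (\<lambda>x\<in>\<Delta>. x)"
      proof (rule ccontr)
        assume "\<not> ?thesis"
        then have "n = (\<lambda>f\<in>R. f)"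
          using n by (intro N.H_eqI) (auto simp: diag intro!: R_eqI)
        then show False using n by simp
      qed
      then obtain i where i: "i \<in> I" "h i \<noteq> (\<lambda>x\<in>\<Delta>. x)" by blast
      have hi: "h i \<in> M" using h i by auto
      \<comment> \<open>The component \<open>h i\<close> fixes \<open>f i\<close>, because
        \<open>n\<close> fixes \<open>f\<close>.\<close>
      show ?thesis
        by (rule bexI[of _ i], rule bexI[of _ "h i"], rule bexI[of _ "f i"])
          (use i hi f diag[OF f(1) i(1)] commutator_coord_mem[OF N n(1) hi diag i(1)] in auto)
    next
      case False
      then obtain i where i: "i \<in> I" "t i \<noteq> i" by blast
      \<comment> \<open>As \<open>n\<close> moves \<open>i\<close>, the component \<open>m\<close>
        is free; a transitive non-regular \<open>M\<close> has a nontrivial element with a fixed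
        point.\<close>
      obtain m a where "m \<in> M" "a \<in> \<Delta>" "m a = a" "m \<noteq> (\<lambda>x\<in>\<Delta>. x)"
        using nr trM by (auto simp: regular_perm_def M.semiregular_iff)
      then show ?thesis
        using i moved_commutator_mem[OF N n(1) h t form i] by blast
    qed
    then obtain i m a where i: "i \<in> I" and m: "m \<in> M" "a \<in> \<Delta>" "m a = a" "m \<noteq> (\<lambda>x\<in>\<Delta>. x)"
      and comm: "\<And>y. y \<in> M \<Longrightarrow> coord i (commutator \<Delta> m y) \<in> N" by blast
    have D: "transitive_perm \<Delta> {m \<in> M. coord i m \<in> N}"
      by (rule M.semiprimitive_commutators_transitive[OF sp coord_vimage_normal[OF N i] m])
        (use m comm in auto)
    show ?thesis
    proof (rule transitive_of_coords[OF N_sub])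
      fix j a b assume j: "j \<in> I" and ab: "a \<in> \<Delta>" "b \<in> \<Delta>"
      obtain s where s: "s \<in> T" "s i = j"
        using tr i j by (auto simp: T.transitive_iff)
      obtain k where "k \<in> M" "coord i k \<in> N" "k a = b"
        using D ab by (auto simp: transitive_perm_iff)
      then show "\<exists>m\<in>M. m a = b \<and> coord j m \<in> N"
        using coord_conj_top[OF N _ _ s(1) i] s(2) by blast
    qed
  qed
  then show "transitive_perm R N \<or> semiregular_perm R N" by blast
qed

text \<open>Components with fixed points are trivial here, so \<open>n\<close> must move a
  coordinate. Faithfulness gives a moved coordinate in every \<open>T\<close>-orbit, and perfectness
  passes from the commutators there to all of \<open>M\<close>.\<close>

lemma semiprimitive_G_regular:
  assumes reg: "regular_perm \<Delta> M" and perfect: "perfect_perm \<Delta> M"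
    and faithful: "faithful_on_orbits I T"
  shows "semiprimitive_perm R G"
  unfolding semiprimitive_perm_def
proof (intro conjI allI impI)
  have trM: "transitive_perm \<Delta> M" using reg by (simp add: regular_perm_def)
  then show "transitive_perm R G" by (rule transitive_G)
  fix N assume N: "N \<lhd> perm_grp R G"
  have N_sub: "subgroup N (BijGroup R)" and NG: "N \<subseteq> G"
    using N by (auto simp: G.normal_perm_grp_iff)
  interpret N: perm_group R N by (rule perm_group.intro[OF N_sub])
  have "transitive_perm R N" if "\<not> semiregular_perm R N"
  proof -
    obtain n f where n: "n \<in> N" "n \<noteq> (\<lambda>f\<in>R. f)" and f: "f \<in> R" "n f = f"
      using \<open>\<not> semiregular_perm R N\<close> by (auto simp: N.semiregular_iff)
    obtain h t where h: "h \<in> I \<rightarrow> M" and t: "t \<in> T"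
      and form: "\<And>f i. f \<in> R \<Longrightarrow> i \<in> I \<Longrightarrow> n f (t i) = h i (f i)"
      using G_form n NG by blast
    have t_ne: "t \<noteq> (\<lambda>i\<in>I. i)"
    proof
      assume t1: "t = (\<lambda>i\<in>I. i)"
      have "h i = (\<lambda>x\<in>\<Delta>. x)" if i: "i \<in> I" for i
      proof -
        have "h i \<in> M" "f i \<in> \<Delta>" using h i f by auto
        moreover have "h i (f i) = f i" using i f(2) form[OF f(1) i] by (simp add: t1)
        ultimately show ?thesis using reg unfolding regular_perm_def M.semiregular_iff by blast
      qed
      then have "n g i = g i" if "g \<in> R" "i \<in> I" for g i
        using form[OF that] that by (simp add: t1)
      then have "n = (\<lambda>f\<in>R. f)"
        using n by (intro N.H_eqI) (auto intro!: R_eqI)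
      then show False using n by simp
    qed
    have all: "coord i m \<in> N" if i: "i \<in> I" and m: "m \<in> M" for i m
    proof -
      \<comment> \<open>A nontrivial \<open>t\<close> cannot fix the orbit of \<open>i\<close>
        pointwise.\<close>
      obtain s where s: "s \<in> T" "t (s i) \<noteq> s i"
        using faithful t t_ne i unfolding T.faithful_on_orbits_iff by blast
      have si: "s i \<in> I" using s i by simp
      have "M \<subseteq> {m \<in> M. coord (s i) m \<in> N}"
      proof (rule M.perfect_subset_of_commutators[OF perfect coord_vimage_normal[OF N si]])
        fix x y assume xy: "x \<in> M" "y \<in> M"
        have "coord (s i) (commutator \<Delta> x y) \<in> N"
          by (rule moved_commutator_mem[OF N n(1) h t form si s(2) xy])
        then show "commutator \<Delta> x y \<in> {m \<in> M. coord (s i) m \<in> N}"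
          using xy by simp
      qed
      then have mem: "coord (s i) m \<in> N" using m by blast
      \<comment> \<open>Conjugation by \<open>s^-1\<close> brings the element from
        \<open>s i\<close> back to \<open>i\<close>.\<close>
      have "coord ((inv\<^bsub>BijGroup I\<^esub> s) (s i)) m \<in> N"
        by (rule coord_conj_top[OF N mem m _ si]) (use s in simp)
      then show ?thesis using s i by simp
    qed
    show ?thesis
      by (rule transitive_of_coords[OF N_sub]) (use all trM M.transitive_iff in blast)
  qed
  then show "transitive_perm R N \<or> semiregular_perm R N" by blast
qed

subsection \<open>Necessity\<close>

text \<open>A nontrivial \<open>p \<in> P\<close> with a fixed point, placed at coordinate
  \<open>i\<close>, preserves the coordinatewise \<open>P\<close>-orbits and has a fixed point in
  \<open>R\<close>. So there is one class in \<open>R\<close>, hence one \<open>P\<close>-orbit on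
  \<open>\<Delta>\<close>.\<close>

lemma semiprimitive_M:
  assumes sp: "semiprimitive_perm R G" and tr: "transitive_perm \<Delta> M" and i: "i \<in> I"
  shows "semiprimitive_perm \<Delta> M"
  unfolding semiprimitive_perm_def
proof (intro conjI allI impI tr)
  fix P assume P: "P \<lhd> perm_grp \<Delta> M"
  have P_sub: "subgroup P (BijGroup \<Delta>)" and PM: "P \<subseteq> M"
    using P by (auto simp: M.normal_perm_grp_iff)
  interpret P: perm_group \<Delta> P by (rule perm_group.intro[OF P_sub])
  note eq = M.equiv_orbit_rel[OF P_sub]
  define r where "r = {(f, g). f \<in> R \<and> g \<in> R \<and> (\<forall>i\<in>I. (f i, g i) \<in> M.orbit_rel P)}"
  have o_refl: "(x, x) \<in> M.orbit_rel P" if "x \<in> \<Delta>" for x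
    using eq that by (auto elim: equivE simp: refl_on_def)
  have o_sym: "(y, x) \<in> M.orbit_rel P" if "(x, y) \<in> M.orbit_rel P" for x y
    using eq that by (auto elim: equivE dest: symD)
  have o_trans: "(x, z) \<in> M.orbit_rel P"
    if "(x, y) \<in> M.orbit_rel P" "(y, z) \<in> M.orbit_rel P" for x y z
    using eq that by (auto elim: equivE dest: transD)
  have r: "equiv R r"
  proof (rule equivI)
    show "refl_on R r" by (simp add: r_def refl_on_def o_refl)
    show "sym r" by (auto simp: r_def sym_def intro: o_sym)
    show "trans r" unfolding trans_def r_def using o_trans by blast
  qed (auto simp: r_def)
  have inv: "(g x, g y) \<in> r" if g: "g \<in> G" and xy: "(x, y) \<in> r" for g x y
  proof -
    obtain h t where h: "h \<in> I \<rightarrow> M" and t: "t \<in> T"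
      and form: "\<And>f i. f \<in> R \<Longrightarrow> i \<in> I \<Longrightarrow> g f (t i) = h i (f i)"
      using G_form g by blast
    have xyR: "x \<in> R" "y \<in> R" using xy by (auto simp: r_def)
    have "(g x j, g y j) \<in> M.orbit_rel P" if "j \<in> I" for j
    proof -
      obtain k where k: "k \<in> I" "j = t k" using T_surj[OF t \<open>j \<in> I\<close>] by blast
      show ?thesis
        unfolding k(2) form[OF xyR(1) k(1)] form[OF xyR(2) k(1)]
        by (rule M.orbit_rel_invariant[OF P]) (use h k xy in \<open>auto simp: r_def\<close>)
    qed
    then show ?thesis using xyR g by (simp add: r_def)
  qed
  have "transitive_perm \<Delta> P" if "\<not> semiregular_perm \<Delta> P"
  proof (rule M.transitive_of_orbit_rel[OF P_sub])
    obtain p a where p: "p \<in> P" "a \<in> \<Delta>" "p a = a" "p \<noteq> (\<lambda>x\<in>\<Delta>. x)"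
      using \<open>\<not> semiregular_perm \<Delta> P\<close> by (auto simp: P.semiregular_iff)
    have pM: "p \<in> M" using p PM by auto
    \<comment> \<open>These points copy \<open>\<Delta>\<close> into \<open>R\<close> along
      coordinate \<open>i\<close>: \<open>?at a\<close> is the fixed point, and comparing
      \<open>?at x\<close> with \<open>?at y\<close> at \<open>i\<close> recovers the orbit
      relation.\<close>
    let ?at = "\<lambda>x. (\<lambda>i\<in>I. \<delta>)(i := x)"
    have p_r: "(f, coord i p f) \<in> r" if f: "f \<in> R" for f
    proof -
      have "(f j, (f(i := p (f i))) j) \<in> M.orbit_rel P" if "j \<in> I" for j
        using o_refl f that p by (auto simp: M.orbit_rel_def)
      then show ?thesis using f i pM by (simp add: r_def)
    qed
    have at_R: "?at x \<in> R" if "x \<in> \<Delta>" for x using that i by simp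
    have fixed: "coord i p (?at a) = ?at a" and ne: "coord i p \<noteq> (\<lambda>f\<in>R. f)"
      using p pM i coord_eq_one_iff[OF pM i] by simp_all
    fix x y assume xy: "x \<in> \<Delta>" "y \<in> \<Delta>"
    have "(?at x, ?at y) \<in> r"
      by (rule G.semiprimitive_class_kernel[OF sp r])
        (fact inv coord_mem[OF pM] p_r at_R[OF p(2)] fixed ne at_R[OF xy(1)] at_R[OF xy(2)])+
    then have "(?at x i, ?at y i) \<in> M.orbit_rel P" unfolding r_def using i by blast
    then show "(x, y) \<in> M.orbit_rel P" by simp
  qed
  then show "transitive_perm \<Delta> P \<or> semiregular_perm \<Delta> P" by blast
qed

text \<open>Agreement on a \<open>T\<close>-invariant set \<open>J\<close> is a
  \<open>G\<close>-invariant relation whose classes \<open>k\<close> preserves. Since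
  \<open>J\<close> is nonempty and \<open>\<Delta>\<close> has a second point, there is more than
  one class, so \<open>k\<close> with its fixed point \<open>f\<close> must be trivial.\<close>

lemma semiprimitive_trivial_on_coords:
  assumes sp: "semiprimitive_perm R G" and J: "J \<subseteq> I" "i \<in> J"
    and J_inv: "\<And>t j. t \<in> T \<Longrightarrow> j \<in> I \<Longrightarrow> t j \<in> J \<Longrightarrow> j \<in> J"
    and k: "k \<in> G" "\<And>f j. f \<in> R \<Longrightarrow> j \<in> J \<Longrightarrow> k f j = f j" and f: "f \<in> R" "k f = f"
    and a: "a \<in> \<Delta>" "a \<noteq> \<delta>"
  shows "k = (\<lambda>f\<in>R. f)"
proof (rule ccontr)
  assume ne: "k \<noteq> (\<lambda>f\<in>R. f)"
  define r where "r = {(f, g). f \<in> R \<and> g \<in> R \<and> (\<forall>j\<in>J. f j = g j)}"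
  have r: "equiv R r"
    by (rule equivI) (auto simp: r_def refl_on_def sym_def trans_def)
  have inv: "(g x, g y) \<in> r" if g: "g \<in> G" and xy: "(x, y) \<in> r" for g x y
  proof -
    obtain h t where h: "h \<in> I \<rightarrow> M" and t: "t \<in> T"
      and form: "\<And>f i. f \<in> R \<Longrightarrow> i \<in> I \<Longrightarrow> g f (t i) = h i (f i)"
      using G_form g by blast
    have xyR: "x \<in> R" "y \<in> R" using xy by (auto simp: r_def)
    have "g x j = g y j" if j: "j \<in> J" for j
    proof -
      \<comment> \<open>Entry \<open>j\<close> of \<open>g x\<close> comes from entry
        \<open>k\<close> of \<open>x\<close>, and \<open>J_inv\<close> keeps \<open>k\<close> in
        \<open>J\<close>.\<close>
      obtain k where k: "k \<in> I" "j = t k" using T_surj[OF t, of j] J j by blast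
      then have "k \<in> J" using J_inv[OF t] j by blast
      then show ?thesis
        unfolding k(2) form[OF xyR(1) k(1)] form[OF xyR(2) k(1)] using xy by (auto simp: r_def)
    qed
    then show ?thesis using xyR g by (simp add: r_def)
  qed
  have k_r: "(f, k f) \<in> r" if "f \<in> R" for f
    using that k by (simp add: r_def)
  have iI: "i \<in> I" using J by auto
  then have upd: "(\<lambda>i\<in>I. \<delta>)(i := a) \<in> R" using a by simp
  have "(\<lambda>i\<in>I. \<delta>, (\<lambda>i\<in>I. \<delta>)(i := a)) \<in> r"
    by (rule G.semiprimitive_class_kernel[OF sp r]) (fact inv k(1) k_r f ne const_R upd)+
  then have "(\<lambda>i\<in>I. \<delta>) i = ((\<lambda>i\<in>I. \<delta>)(i := a)) i" unfolding r_def using J by blast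
  then show False using iI a by simp
qed

text \<open>If \<open>j\<close> is outside the orbit of \<open>i\<close>, take \<open>J\<close> to
  be the complement of that orbit. A nontrivial \<open>m\<close> with a fixed point, acting at
  \<open>i\<close>, is then trivial on \<open>J\<close>, a contradiction.\<close>

lemma transitive_T_of_nonregular:
  assumes sp: "semiprimitive_perm R G" and tr: "transitive_perm \<Delta> M"
    and nr: "\<not> regular_perm \<Delta> M" and a: "a \<in> \<Delta>" "a \<noteq> \<delta>"
  shows "transitive_perm I T"
  unfolding T.transitive_iff
proof (intro ballI, rule ccontr)
  fix i j assume i: "i \<in> I" and j: "j \<in> I" and no: "\<not> (\<exists>t\<in>T. t i = j)"
  obtain m b where m: "m \<in> M" "b \<in> \<Delta>" "m b = b" "m \<noteq> (\<lambda>x\<in>\<Delta>. x)"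
    using nr tr by (auto simp: regular_perm_def M.semiregular_iff)
  define J where "J = I - {t i | t. t \<in> T}"
  have J_inv: "k \<in> J" if t: "t \<in> T" "k \<in> I" "t k \<in> J" for t k
  proof -
    have "k \<noteq> s i" if "s \<in> T" for s
    proof
      assume "k = s i"
      then have "t k = (t \<otimes>\<^bsub>BijGroup I\<^esub> s) i" using t that i by simp
      moreover have "t \<otimes>\<^bsub>BijGroup I\<^esub> s \<in> T" using t that by simp
      ultimately show False using t(3) by (auto simp: J_def)
    qed
    then show ?thesis using t by (auto simp: J_def)
  qed
  have iJ: "i \<notin> J" using i by (auto simp: J_def intro!: exI[of _ "\<lambda>x\<in>I. x"])
  have "coord i m = (\<lambda>f\<in>R. f)"
  proof (rule semiprimitive_trivial_on_coords[OF sp])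
    show "J \<subseteq> I" "j \<in> J" using j no by (auto simp: J_def)
    show "coord i m f k = f k" if "f \<in> R" "k \<in> J" for f k
      using that iJ m i by auto
    show "(\<lambda>i\<in>I. \<delta>)(i := b) \<in> R" "coord i m ((\<lambda>i\<in>I. \<delta>)(i := b)) = (\<lambda>i\<in>I. \<delta>)(i := b)"
      using m i by simp_all
  qed (fact J_inv coord_mem[OF m(1)] a)+
  then show False using coord_eq_one_iff[OF m(1) i] m by simp
qed

text \<open>With \<open>J\<close> an orbit fixed pointwise by \<open>t\<close>, the permutation
  \<open>top_perm I \<Delta> \<delta> t\<close> changes no entry in \<open>J\<close> and fixes the
  constant point, so it is trivial.\<close>

lemma faithful_T:
  assumes sp: "semiprimitive_perm R G" and a: "a \<in> \<Delta>" "a \<noteq> \<delta>"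
  shows "faithful_on_orbits I T"
  unfolding T.faithful_on_orbits_iff
proof (intro ballI impI)
  fix i t assume i: "i \<in> I" and t: "t \<in> T" and triv: "\<forall>s\<in>T. t (s i) = s i"
  define J where "J = {s i | s. s \<in> T}"
  have J_inv: "k \<in> J" if s: "s \<in> T" "k \<in> I" "s k \<in> J" for s k
  proof -
    obtain u where u: "u \<in> T" "s k = u i" using s by (auto simp: J_def)
    then have "k = (inv\<^bsub>BijGroup I\<^esub> s \<otimes>\<^bsub>BijGroup I\<^esub> u) i"
      using s i T.H_apply(3)[OF s(1,2)] by simp
    moreover have "inv\<^bsub>BijGroup I\<^esub> s \<otimes>\<^bsub>BijGroup I\<^esub> u \<in> T" using s u by simp
    ultimately show ?thesis by (auto simp: J_def)
  qed
  have "top_perm I \<Delta> \<delta> t = (\<lambda>f\<in>R. f)"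
  proof (rule semiprimitive_trivial_on_coords[OF sp])
    show "J \<subseteq> I" "i \<in> J" using i by (auto simp: J_def intro!: exI[of _ "\<lambda>x\<in>I. x"])
    show "top_perm I \<Delta> \<delta> t f k = f k" if "f \<in> R" "k \<in> J" for f k
    proof -
      have "k \<in> I" "t k = k" using that triv i by (auto simp: J_def)
      then show ?thesis using top_perm_apply[OF that(1) t, of k] by simp
    qed
  qed (fact J_inv const_R top_perm_const[OF t] top_perm_mem[OF t] a)+
  then show "t = (\<lambda>x\<in>I. x)" using top_perm_ne_one[OF t _ a] by blast
qed

text \<open>
  For regular \<open>M\<close>, a point \<open>x\<close> of \<open>\<Delta>\<close> is \<open>m \<delta>\<close> for a unique \<open>m\<close>. Multiplying the cosets of these
  \<open>m\<close> modulo the derived subgroup over all coordinates gives a map on \<^term>\<open>R\<close> whose fibres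
  are permuted by \<^term>\<open>G\<close>, and each of which is fixed by \<open>T\<close>. So all points lie in one fibre.
\<close>

lemma perfect_M:
  assumes sp: "semiprimitive_perm R G" and reg: "regular_perm \<Delta> M"
    and t0: "t0 \<in> T" "t0 \<noteq> (\<lambda>i\<in>I. i)" and a: "a \<in> \<Delta>" "a \<noteq> \<delta>"
  shows "perfect_perm \<Delta> M"
proof -
  define P where "P = perm_grp \<Delta> M"
  define D where "D = derived P M"
  define Q where "Q = P Mod D"
  have carrier_P: "carrier P = M" by (simp add: P_def)
  interpret P: group P unfolding P_def by (rule group_perm_grp[OF subgroup_M])
  interpret D: normal D P
    unfolding D_def using P.derived_is_normal[OF P.normal_self] by (simp add: carrier_P)
  \<comment> \<open>Commutativity of the abelianization \<open>Q\<close> is what allows unordered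
    products over coordinates.\<close>
  interpret Q: comm_group Q
    unfolding Q_def D_def using P.derived_quot_is_comm_group by (simp add: carrier_P)
  have coset_carrier: "D #>\<^bsub>P\<^esub> m \<in> carrier Q" if "m \<in> M" for m
    using that by (auto simp: Q_def FactGroup_def RCOSETS_def carrier_P)
  have coset_mult: "D #>\<^bsub>P\<^esub> (m \<otimes>\<^bsub>BijGroup \<Delta>\<^esub> k) = (D #>\<^bsub>P\<^esub> m) \<otimes>\<^bsub>Q\<^esub> (D #>\<^bsub>P\<^esub> k)"
    if "m \<in> M" "k \<in> M" for m k
    using hom_mult[OF D.r_coset_hom_Mod, of m k] that by (simp add: Q_def carrier_P) (simp add: P_def)
  have coset_one: "D #>\<^bsub>P\<^esub> (\<lambda>x\<in>\<Delta>. x) = \<one>\<^bsub>Q\<^esub>"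
    using P.coset_mult_one[OF D.subset] by (simp add: Q_def P_def)

  \<comment> \<open>Transitivity gives existence and trivial stabilisers give uniqueness of the
    \<open>m\<close> chosen by \<open>THE\<close>.\<close>
  define c where "c x = D #>\<^bsub>P\<^esub> (THE m. m \<in> M \<and> m \<delta> = x)" for x
  have c_eq: "c (m \<delta>) = D #>\<^bsub>P\<^esub> m" if m: "m \<in> M" for m
  proof -
    have "k = m" if k: "k \<in> M" "k \<delta> = m \<delta>" for k
    proof -
      have one: "inv\<^bsub>BijGroup \<Delta>\<^esub> m \<otimes>\<^bsub>BijGroup \<Delta>\<^esub> k \<in> M"
        "(inv\<^bsub>BijGroup \<Delta>\<^esub> m \<otimes>\<^bsub>BijGroup \<Delta>\<^esub> k) \<delta> = \<delta>"
        using m k \<delta> by simp_all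
      then have eq: "inv\<^bsub>BijGroup \<Delta>\<^esub> m \<otimes>\<^bsub>BijGroup \<Delta>\<^esub> k = (\<lambda>x\<in>\<Delta>. x)"
        using reg \<delta> unfolding regular_perm_def M.semiregular_iff by blast
      show "k = m"
      proof (rule M.H_eqI[OF k(1) m])
        fix x assume x: "x \<in> \<Delta>"
        have "(inv\<^bsub>BijGroup \<Delta>\<^esub> m) (k x) = x"
          using fun_cong[OF eq, of x] m k x by simp
        then show "k x = m x" using M.H_apply(4)[OF m, of "k x"] k x by simp
      qed
    qed
    then have "(THE k. k \<in> M \<and> k \<delta> = m \<delta>) = m" using m by blast
    then show ?thesis by (simp add: c_def)
  qed
  have point: "\<exists>m\<in>M. x = m \<delta>" if "x \<in> \<Delta>" for x
    using reg that \<delta> unfolding regular_perm_def M.transitive_iff by metis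
  have c_carrier [simp]: "c x \<in> carrier Q" if "x \<in> \<Delta>" for x
    using point[OF that] c_eq coset_carrier by auto
  have c_mult: "c (k x) = (D #>\<^bsub>P\<^esub> k) \<otimes>\<^bsub>Q\<^esub> c x" if k: "k \<in> M" and x: "x \<in> \<Delta>" for k x
  proof -
    obtain m where m: "m \<in> M" "x = m \<delta>" using point[OF x] by blast
    then have "k x = (k \<otimes>\<^bsub>BijGroup \<Delta>\<^esub> m) \<delta>" using k \<delta> by simp
    then show ?thesis using c_eq[of "k \<otimes>\<^bsub>BijGroup \<Delta>\<^esub> m"] c_eq[OF m(1)] k m coset_mult by simp
  qed
  \<comment> \<open>Entries equal to \<open>\<delta>\<close> contribute the neutral factor, so the
    product over the finite support may be taken over any larger finite set.\<close>
  have c_\<delta>: "c \<delta> = \<one>\<^bsub>Q\<^esub>"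
    using c_eq[of "\<lambda>x\<in>\<Delta>. x"] coset_one \<delta> by simp

  define \<phi> where "\<phi> f = finprod Q (\<lambda>i. c (f i)) {i \<in> I. f i \<noteq> \<delta>}" for f
  have \<phi>_eq: "\<phi> f = finprod Q (\<lambda>i. c (f i)) F"
    if "f \<in> R" "finite F" "F \<subseteq> I" "{i \<in> I. f i \<noteq> \<delta>} \<subseteq> F" for f F
    unfolding \<phi>_def
  proof (rule Q.finprod_mono_neutral_cong_left[OF that(2,4)])
    fix i assume "i \<in> F - {i \<in> I. f i \<noteq> \<delta>}"
    then have "f i = \<delta>" using that(3) by auto
    then show "c (f i) = \<one>\<^bsub>Q\<^esub>" by (simp only: c_\<delta>)
  qed (use that in auto)
  \<comment> \<open>The permutation \<open>t\<close> only reindexes the product, and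
    \<open>c_mult\<close> splits off a factor depending on \<open>h\<close> and \<open>F\<close>
    alone. To capture the support of \<open>g\<close>, the set \<open>F\<close> must also contain
    every place where \<open>h i\<close> moves \<open>\<delta>\<close>.\<close>
  have \<phi>_move: "\<phi> g = finprod Q (\<lambda>i. D #>\<^bsub>P\<^esub> h i) F \<otimes>\<^bsub>Q\<^esub> \<phi> f"
    if f: "f \<in> R" and g: "g \<in> R" and F: "finite F" "F \<subseteq> I" "{i \<in> I. f i \<noteq> \<delta>} \<subseteq> F"
      and h: "h \<in> I \<rightarrow> M" and t: "t \<in> T"
      and form: "\<And>i. i \<in> I \<Longrightarrow> g (t i) = h i (f i)"
      and fixed: "\<And>i. i \<in> I - F \<Longrightarrow> h i \<delta> = \<delta>" for f g F h t
  proof -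
    have hF: "h i \<in> M" "f i \<in> \<Delta>" "t i \<in> I" if "i \<in> F" for i
      using h f t F(2) that by auto
    have inj: "inj_on t F"
      using F(2) t by (intro inj_onI) (simp add: subset_iff)
    have "{j \<in> I. g j \<noteq> \<delta>} \<subseteq> t ` F"
    proof
      fix j assume j: "j \<in> {j \<in> I. g j \<noteq> \<delta>}"
      then obtain i where i: "i \<in> I" "j = t i" using T_surj[OF t, of j] by blast
      have "i \<in> F"
      proof (rule ccontr)
        assume "i \<notin> F"
        then have "f i = \<delta>" "h i \<delta> = \<delta>" using F(3) i fixed by auto
        then show False using j form[OF i(1)] i by simp
      qed
      then show "j \<in> t ` F" using i by blast
    qed
    then have "\<phi> g = finprod Q (\<lambda>j. c (g j)) (t ` F)"
      using g F hF by (intro \<phi>_eq) auto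
    also have "\<dots> = finprod Q (\<lambda>i. c (g (t i))) F"
      by (rule Q.finprod_reindex[OF _ inj]) (use g hF in auto)
    also have "\<dots> = finprod Q (\<lambda>i. (D #>\<^bsub>P\<^esub> h i) \<otimes>\<^bsub>Q\<^esub> c (f i)) F"
    proof (rule Q.finprod_cong')
      show "c (g (t i)) = (D #>\<^bsub>P\<^esub> h i) \<otimes>\<^bsub>Q\<^esub> c (f i)" if "i \<in> F" for i
        using form[of i] c_mult[OF hF(1,2)[OF that]] F(2) that by auto
    qed (use hF coset_carrier in auto)
    also have "\<dots> = finprod Q (\<lambda>i. D #>\<^bsub>P\<^esub> h i) F \<otimes>\<^bsub>Q\<^esub> finprod Q (\<lambda>i. c (f i)) F"
      by (rule Q.finprod_multf) (use hF coset_carrier in auto)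
    also have "finprod Q (\<lambda>i. c (f i)) F = \<phi> f"
      using f F by (intro \<phi>_eq[symmetric]) auto
    finally show ?thesis .
  qed

  define r where "r = {(f, g). f \<in> R \<and> g \<in> R \<and> \<phi> f = \<phi> g}"
  have r: "equiv R r"
    by (rule equivI) (auto simp: r_def refl_on_def sym_def trans_def)
  have invariant: "(g x, g y) \<in> r" if g: "g \<in> G" and xy: "(x, y) \<in> r" for g x y
  proof -
    obtain h t where h: "h \<in> I \<rightarrow> M" and t: "t \<in> T"
      and form: "\<And>f i. f \<in> R \<Longrightarrow> i \<in> I \<Longrightarrow> g f (t i) = h i (f i)"
      using G_form g by blast
    have xyR: "x \<in> R" "y \<in> R" using xy by (auto simp: r_def)
    have gR: "g x \<in> R" "g y \<in> R" "g (\<lambda>i\<in>I. \<delta>) \<in> R" using xyR g by simp_all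
    \<comment> \<open>One set serves both \<open>x\<close> and \<open>y\<close>, so that
      \<open>\<phi>\<close> is multiplied by the same factor at both.\<close>
    define F where "F = {i \<in> I. x i \<noteq> \<delta>} \<union> {i \<in> I. y i \<noteq> \<delta>} \<union> {i \<in> I. h i \<delta> \<noteq> \<delta>}"
    \<comment> \<open>The places where \<open>h i\<close> moves \<open>\<delta>\<close> are carried
      injectively into the support of the image of the constant point, which is finite.\<close>
    have "t ` {i \<in> I. h i \<delta> \<noteq> \<delta>} \<subseteq> {i \<in> I. g (\<lambda>i\<in>I. \<delta>) i \<noteq> \<delta>}"
    proof
      fix j assume "j \<in> t ` {i \<in> I. h i \<delta> \<noteq> \<delta>}"
      then obtain i where i: "i \<in> I" "h i \<delta> \<noteq> \<delta>" "j = t i" by blast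
      then show "j \<in> {i \<in> I. g (\<lambda>i\<in>I. \<delta>) i \<noteq> \<delta>}"
        using t form[OF const_R i(1)] by simp
    qed
    then have "finite (t ` {i \<in> I. h i \<delta> \<noteq> \<delta>})"
      by (rule finite_subset[OF _ R_finite[OF gR(3)]])
    moreover have "inj_on t {i \<in> I. h i \<delta> \<noteq> \<delta>}"
      using t by (intro inj_onI) simp
    ultimately have "finite {i \<in> I. h i \<delta> \<noteq> \<delta>}" by (rule finite_imageD)
    then have F: "finite F"
      unfolding F_def using R_finite[OF xyR(1)] R_finite[OF xyR(2)] by (intro finite_UnI)
    have "\<phi> (g f) = finprod Q (\<lambda>i. D #>\<^bsub>P\<^esub> h i) F \<otimes>\<^bsub>Q\<^esub> \<phi> f" if f: "f = x \<or> f = y" for f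
    proof (rule \<phi>_move[OF _ _ F _ _ h t])
      have fR: "f \<in> R" using f xyR by blast
      then show "f \<in> R" "g f \<in> R" using g by simp_all
      show "g f (t i) = h i (f i)" if "i \<in> I" for i using form[OF fR that] .
    qed (use f in \<open>auto simp: F_def\<close>)
    then show ?thesis using xy gR by (simp add: r_def)
  qed
  \<comment> \<open>All components are trivial, so the factor from \<open>\<phi>_move\<close> is a
    product of trivial cosets.\<close>
  have top_r: "(f, top_perm I \<Delta> \<delta> t0 f) \<in> r" if f: "f \<in> R" for f
  proof -
    have tR: "top_perm I \<Delta> \<delta> t0 f \<in> R" using f t0 by simp
    have "\<phi> (top_perm I \<Delta> \<delta> t0 f) =
        finprod Q (\<lambda>i. D #>\<^bsub>P\<^esub> (\<lambda>x\<in>\<Delta>. x)) {i \<in> I. f i \<noteq> \<delta>} \<otimes>\<^bsub>Q\<^esub> \<phi> f"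
      by (rule \<phi>_move[OF f tR R_finite[OF f] _ _ _ t0(1)]) (use f t0 \<delta> in auto)
    moreover have "\<phi> f \<in> carrier Q"
      unfolding \<phi>_def using f by (intro Q.finprod_closed) auto
    ultimately show ?thesis using f tR by (simp add: r_def coset_one)
  qed

  have "M \<subseteq> D"
  proof
    fix m assume m: "m \<in> M"
    obtain i where i: "i \<in> I" using t0 T.H_eqI[of t0 "\<lambda>i\<in>I. i"] by auto
    \<comment> \<open>Its only entry that can differ from \<open>\<delta>\<close> is
      \<open>m \<delta>\<close>, so \<open>\<phi> ?g\<close> is the coset of \<open>m\<close>,
      whereas \<open>\<phi>\<close> is neutral at the constant point.\<close>
    let ?g = "(\<lambda>i\<in>I. \<delta>)(i := m \<delta>)"
    have gR: "?g \<in> R" and m\<delta>: "m \<delta> \<in> \<Delta>" using m i \<delta> by simp_all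
    \<comment> \<open>The nontrivial element given by \<open>t0\<close> fixes the constant point and
      preserves every fibre of \<open>\<phi>\<close>, so there is only one fibre.\<close>
    have "(\<lambda>i\<in>I. \<delta>, ?g) \<in> r"
      by (rule G.semiprimitive_class_kernel[OF sp r])
        (fact invariant top_perm_mem[OF t0(1)] top_r top_perm_const[OF t0(1)]
          top_perm_ne_one[OF t0 a] const_R gR)+
    then have "\<phi> (\<lambda>i\<in>I. \<delta>) = \<phi> ?g" by (simp add: r_def)
    moreover have "\<phi> (\<lambda>i\<in>I. \<delta>) = \<one>\<^bsub>Q\<^esub>"
      unfolding \<phi>_def by (rule Q.finprod_one_eqI) auto
    moreover have "\<phi> ?g = finprod Q (\<lambda>j. c (?g j)) {i}"
      by (rule \<phi>_eq[OF gR]) (use i in auto)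
    moreover have "\<dots> = c (m \<delta>)" using m\<delta> by simp
    ultimately have "D #>\<^bsub>P\<^esub> m = D" using c_eq[OF m] by (simp add: Q_def)
    then show "m \<in> D"
      using P.rcos_self[OF _ D.subgroup_axioms, of m] m by (simp add: carrier_P)
  qed
  then show ?thesis
    using D.subset by (auto simp: perfect_perm_def D_def P_def)
qed

end

theorem theorem9p7:
  fixes \<Delta> :: "'d set" and I :: "'i set"
    and M :: "('d \<Rightarrow> 'd) set" and T :: "('i \<Rightarrow> 'i) set" and \<delta> :: 'd
  assumes "\<exists>a\<in>\<Delta>. \<exists>b\<in>\<Delta>. a \<noteq> b"
    and "subgroup M (BijGroup \<Delta>)" and "transitive_perm \<Delta> M"
    and "subgroup T (BijGroup I)" and "T \<noteq> {\<one>\<^bsub>BijGroup I\<^esub>}"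
    and "\<delta> \<in> \<Delta>"
  shows "semiprimitive_perm (res_pow I \<Delta> \<delta>) (res_wreath I \<Delta> \<delta> M T) \<longleftrightarrow>
      (semiprimitive_perm \<Delta> M \<and> \<not> regular_perm \<Delta> M \<and> transitive_perm I T) \<or>
      (regular_perm \<Delta> M \<and> perfect_perm \<Delta> M \<and> faithful_on_orbits I T)"
proof -
  interpret wreath_product_action \<Delta> I M T \<delta>
    by (rule wreath_product_action.intro) fact+
  obtain a where a: "a \<in> \<Delta>" "a \<noteq> \<delta>" using assms(1) by metis
  obtain t where t: "t \<in> T" "t \<noteq> (\<lambda>i\<in>I. i)"
    using assms(5) T.H_closed(1) unfolding one_BijGroup by blast
  then obtain i where i: "i \<in> I" using T.H_eqI[of t "\<lambda>i\<in>I. i"] by auto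
  \<comment> \<open>In the forward direction, regularity of \<open>M\<close> decides which
    alternative holds.\<close>
  show ?thesis
    using semiprimitive_G_nonregular semiprimitive_G_regular semiprimitive_M[OF _ assms(3) i]
      transitive_T_of_nonregular[OF _ assms(3) _ a] faithful_T[OF _ a] perfect_M[OF _ _ t a]
    by blast
qed

end
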